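(* The map induced by $\partial_H$ on the homology $H_*(\mathcal G,\partial_E)$ is zero: if $X\in\mathcal G$ satisfies $\partial_EX=0$, then $\partial_HX\in\partial_E(\mathcal G)$.
   Context: Graphs. A graph is a finite 1-dimensional CW complex (not necessarily connected, multiple edges allowed, the empty graph allowed) all of whose vertices have valence at least 3. A labelling of a graph is a numbering $1,2,\dots$ of its vertices together with an arrow on each edge. An orientation is an equivalence class of labellings: reversing the arrow on one edge, or switching the numbers of two vertices, changes the orientation to the opposite one. $\mathcal G$ is the vector space, over a fixed field of characteristic zero, of linear combinations of (isomorphism classes of) oriented graphs modulo $(X,or)=-(X,-or)$; it is graded by the number of vertices. A graph with a loop is zero in $\mathcal G$, so graphs may be assumed loopless. The orientation is suppressed from the notation. Collapse. For a (non-loop) edge $e$ of $X$, $X_e$ is obtained by collapsing $e$ to a point. Induced orientation: represent the orientation of $X$ by a labelling in which the initial vertex of $e$ is 1 and the terminal vertex is 2; in $X_e$ the vertex resulting from the collapse is numbered 1, the numbers of all other vertices are reduced by one, and arrows on uncontracted edges are unchanged. Half-edges. Each half-edge $h$ begins at a vertex $v(h)$, lies in an edge $e(h)$, and has a complementary half-edge $\bar h$ with $e(h)=h\cup\bar h$. For distinct half-edges $h,k$ with $k\ne\bar h$, $X\langle hk\rangle$ is obtained by cutting $e(h)$ and $e(k)$ at their midpoints and gluing $h$ to $k$ and $\bar h$ to $\bar k$; orientation: represent the orientation of $X$ so that $h$ is the initial half-edge of $e(h)$ and $k$ is the terminal half-edge of $e(k)$; in $X\langle hk\rangle$ the edge $h\cup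 k$ is directed from $h$ to $k$ and the edge $\bar h\cup\bar k$ from $\bar k$ to $\bar h$, all else unchanged. If $v(h)\ne v(k)$, $X_{hk}:=(X\langle hk\rangle)_{h\cup k}$; if $v(h)=v(k)$, $X_{hk}:=0$. One has $X_{hk}=X_{kh}$. Operators (extended linearly): $\partial_E X=\sum_e X_e$, sum over all edges $e$ of $X$; $\partial_H X=\sum X_{hk}$, sum over all unordered pairs $\{h,k\}$ of distinct half-edges of $X$ with $k\neq\bar h$. They satisfy $\partial_E^2=0$ and $\partial_E\partial_H=-\partial_H\partial_E$, so $\partial_H$ induces a map on $H_*(\mathcal G,\partial_E)$. *)

theory Defs
  imports Complex_Main "HOL-Library.Poly_Mapping" "HOL-Combinatorics.Permutations"
begin

text \<open>
  A labelled graph with \<open>n\<close> vertices is a pair \<open>(n, es)\<close>: the numbering identifies the vertices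
  with \<open>1, \<dots>, n\<close>, and \<open>es\<close> lists the edges as pairs (initial vertex, terminal vertex) given by
  the arrows.  Repetitions (multiple edges), loops, disconnected graphs and the empty graph
  \<open>(0, [])\<close> are allowed.  The order of the list only serves to name edges and half-edges; it is
  forgotten in \<open>graph_relations\<close> below.  A loop contributes 2 to the valence of its vertex.
\<close>

definition valence :: "nat \<Rightarrow> (nat \<times> nat) list \<Rightarrow> nat" where
  "valence v es = (\<Sum>(a, b)\<leftarrow>es. of_bool (a = v) + of_bool (b = v))"

definition is_lgraph :: "nat \<times> (nat \<times> nat) list \<Rightarrow> bool" where
  "is_lgraph = (\<lambda>(n, es). set es \<subseteq> {1..n} \<times> {1..n} \<and> (\<forall>v\<in>{1..n}. 3 \<le> valence v es))"

lemma valence_simps [simp]: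
  "valence v [] = 0"
  "valence v ((a, b) # es) = of_bool (a = v) + of_bool (b = v) + valence v es"
  "valence v (es @ es') = valence v es + valence v es'"
  by (simp_all add: valence_def)

typedef lgraph = "{G. is_lgraph G}"
  by (rule exI[of _ "(0, [])"]) (simp add: is_lgraph_def)

setup_lifting type_definition_lgraph

lift_definition nverts :: "lgraph \<Rightarrow> nat" is fst .
lift_definition edges :: "lgraph \<Rightarrow> (nat \<times> nat) list" is snd .

lemma lgraph_eqI: "nverts X = nverts Y \<Longrightarrow> edges X = edges Y \<Longrightarrow> X = Y"
  by transfer (simp add: prod_eq_iff)

lemma set_edges: "set (edges X) \<subseteq> {1..nverts X} \<times> {1..nverts X}"
  by transfer (simp add: is_lgraph_def split_beta)

lemma edges_range: "i < length (edges X) \<Longrightarrow> edges X ! i \<in> {1..nverts X} \<times> {1..nverts X}"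
  using set_edges nth_mem by (metis subsetD)


subsection \<open>Operations on labelled graphs\<close>

lemma valence_map_perm:
  assumes "p permutes S"
  shows "valence v (map (map_prod p p) es) = valence (inv p v) es"
proof -
  have "p a = v \<longleftrightarrow> a = inv p v" for a
    using assms by (metis permutes_inverses(1,2))
  then show ?thesis by (induction es) auto
qed

lemma valence_mset: "mset es = mset es' \<Longrightarrow> valence v es = valence v es'"
  unfolding valence_def by (simp only: sum_mset_sum_list[symmetric] mset_map)

lemma valence_update:
  assumes "i < length es"
  shows "valence v (es[i := (a, b)]) + valence v [es ! i] = valence v es + valence v [(a, b)]"
proof -
  have 1: "es[i := (a, b)] = take i es @ (a, b) # drop (Suc i) es"
    using assms by (rule upd_conv_take_nth_drop)
  have 2: "es = take i es @ es ! i # drop (Suc i) es"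
    using assms by (rule id_take_nth_drop)
  obtain c d where cd: "es ! i = (c, d)" by force
  show ?thesis unfolding 1 by (subst (4) 2) (simp add: cd)
qed

lift_definition relabel :: "(nat \<Rightarrow> nat) \<Rightarrow> lgraph \<Rightarrow> lgraph" is
  "\<lambda>p (n, es). (n, if p permutes {1..n} then map (map_prod p p) es else es)"
proof (clarsimp simp: is_lgraph_def)
  fix p :: "nat \<Rightarrow> nat" and n es
  assume es: "set es \<subseteq> {Suc 0..n} \<times> {Suc 0..n}" "\<forall>v\<in>{Suc 0..n}. 3 \<le> valence v es"
    and p: "p permutes {Suc 0..n}"
  have "\<forall>v\<in>{Suc 0..n}. 3 \<le> valence v (map (map_prod p p) es)"
    using es p by (metis valence_map_perm permutes_in_image permutes_inv)
  moreover have "map_prod p p ` set es \<subseteq> {Suc 0..n} \<times> {Suc 0..n}"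
    using es(1) permutes_in_image[OF p] by fastforce
  ultimately show "map_prod p p ` set es \<subseteq> {Suc 0..n} \<times> {Suc 0..n} \<and>
      (\<forall>v\<in>{Suc 0..n}. 3 \<le> valence v (map (map_prod p p) es))" by simp
qed

lift_definition reverse_edge :: "nat \<Rightarrow> lgraph \<Rightarrow> lgraph" is
  "\<lambda>i (n, es). (n, if i < length es then es[i := prod.swap (es ! i)] else es)"
proof (clarsimp simp: is_lgraph_def)
  fix i n :: nat and es :: "(nat \<times> nat) list"
  assume es: "set es \<subseteq> {Suc 0..n} \<times> {Suc 0..n}" "\<forall>v\<in>{Suc 0..n}. 3 \<le> valence v es"
    and i: "i < length es"
  obtain a b where ab: "es ! i = (a, b)" by force
  have "valence v (es[i := (b, a)]) = valence v es" for v
    using valence_update[OF i, of v b a] ab by simp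
  moreover have "(b, a) \<in> {Suc 0..n} \<times> {Suc 0..n}"
    using es(1) nth_mem[OF i] ab by auto
  ultimately show "set (es[i := prod.swap (es ! i)]) \<subseteq> {Suc 0..n} \<times> {Suc 0..n} \<and>
      (\<forall>v\<in>{Suc 0..n}. 3 \<le> valence v (es[i := prod.swap (es ! i)]))"
    using es ab set_update_subset_insert[of es i "(b, a)"] by auto
qed

text \<open>
  Contracting an edge that runs from vertex 1 to vertex 2 merges these two into vertex 1 and reduces
  the numbers of the other vertices by one.
\<close>

definition merge12 :: "nat \<Rightarrow> nat" where
  "merge12 v = (if v = 1 then 1 else v - 1)"

definition remove_nth :: "nat \<Rightarrow> 'a list \<Rightarrow> 'a list" where
  "remove_nth i xs = take i xs @ drop (Suc i) xs"

lemma valence_merge12: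
  assumes "set es \<subseteq> {1..n} \<times> {1..n}" "1 \<le> v"
  shows "valence v (map (map_prod merge12 merge12) es) =
    (if v = 1 then valence 1 es + valence 2 es else valence (Suc v) es)"
  using assms by (induction es) (auto simp: merge12_def)

lemma is_lgraph_contract12:
  assumes G: "is_lgraph (n, es)" and i: "i < length es" and e: "es ! i = (1, 2)"
  shows "is_lgraph (n - 1, map (map_prod merge12 merge12) (remove_nth i es))"
proof -
  let ?r = "remove_nth i es"
  have es: "set es \<subseteq> {1..n} \<times> {1..n}" "\<forall>v\<in>{1..n}. 3 \<le> valence v es"
    using G by (auto simp: is_lgraph_def)
  have split: "es = take i es @ es ! i # drop (Suc i) es"
    using i by (rule id_take_nth_drop)
  have val: "valence v es = valence v ?r + of_bool (v = 1) + of_bool (v = 2)" for v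
    by (subst split) (auto simp: remove_nth_def e)
  have n: "2 \<le> n" using es(1) nth_mem[OF i] e by auto
  have sub: "set ?r \<subseteq> {1..n} \<times> {1..n}"
    using es(1) by (auto simp: remove_nth_def dest!: in_set_takeD in_set_dropD)
  have "map_prod merge12 merge12 ` set ?r \<subseteq> {1..n - 1} \<times> {1..n - 1}"
    using sub n by (fastforce simp: merge12_def)
  moreover have "3 \<le> valence v (map (map_prod merge12 merge12) ?r)"
    if v: "1 \<le> v" "v \<le> n - 1" for v
  proof (cases "v = 1")
    case True
    have "3 \<le> valence 1 es" "3 \<le> valence 2 es" using es(2) n by auto
    then show ?thesis using val[of 1] val[of 2] True valence_merge12[OF sub, of v] by simp
  next
    case False
    then have "3 \<le> valence (Suc v) es" using es(2) v by auto
    then show ?thesis using val[of "Suc v"] False v valence_merge12[OF sub, of v] by simp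
  qed
  ultimately show ?thesis by (auto simp: is_lgraph_def)
qed

lift_definition contract12 :: "nat \<Rightarrow> lgraph \<Rightarrow> lgraph" is
  "\<lambda>i (n, es). if i < length es \<and> es ! i = (1, 2)
     then (n - 1, map (map_prod merge12 merge12) (remove_nth i es)) else (n, es)"
  by (auto simp del: One_nat_def intro: is_lgraph_contract12 split: prod.splits)

text \<open>
  The half-edges of the edge \<open>i\<close> are \<open>(i, True)\<close>, its initial half, and \<open>(i, False)\<close>, its terminal
  half.
\<close>

type_synonym half_edge = "nat \<times> bool"

definition half_edges :: "lgraph \<Rightarrow> half_edge set" where
  "half_edges X = {..<length (edges X)} \<times> UNIV"

definition opp :: "half_edge \<Rightarrow> half_edge" where
  "opp h = (fst h, \<not> snd h)"

definition start_in :: "(nat \<times> nat) list \<Rightarrow> half_edge \<Rightarrow> nat" where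
  "start_in es h = (if snd h then fst (es ! fst h) else snd (es ! fst h))"

abbreviation start :: "lgraph \<Rightarrow> half_edge \<Rightarrow> nat" where
  "start X \<equiv> start_in (edges X)"

text \<open>
  Cutting \<open>e(h)\<close> and \<open>e(k)\<close> and gluing \<open>h\<close> to \<open>k\<close>.  The new edge \<open>h \<union> k\<close>, directed from \<open>h\<close> to
  \<open>k\<close>, takes the place of \<open>e(h)\<close> in the list of edges, and the new edge consisting of the opposite
  halves, directed from \<open>opp k\<close> to \<open>opp h\<close>, takes the place of \<open>e(k)\<close>.  The labelling of the result
  represents the orientation of $X\langle hk\rangle$ provided that the labelling of \<open>X\<close> has \<open>h\<close> as an
  initial and \<open>k\<close> as a terminal half-edge; in general each of the at most two arrows of \<open>X\<close> that
  have to be reversed first contributes a factor \<open>-1\<close>, and the product is \<open>glue_sign h k\<close>.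
\<close>

lift_definition glue :: "half_edge \<Rightarrow> half_edge \<Rightarrow> lgraph \<Rightarrow> lgraph" is
  "\<lambda>h k (n, es). (n, if fst h < length es \<and> fst k < length es \<and> fst h \<noteq> fst k
     then es[fst h := (start_in es h, start_in es k),
             fst k := (start_in es (opp k), start_in es (opp h))]
     else es)"
proof (clarsimp simp: is_lgraph_def simp del: split_paired_All)
  fix i j n :: nat and b c :: bool and es :: "(nat \<times> nat) list"
  assume es: "set es \<subseteq> {Suc 0..n} \<times> {Suc 0..n}" "\<forall>v\<in>{Suc 0..n}. 3 \<le> valence v es"
    and i: "i < length es" and j: "j < length es" and ij: "i \<noteq> j"
  let ?h = "(i, b)" and ?k = "(j, c)"
  let ?x = "(start_in es ?h, start_in es ?k)"
  let ?y = "(start_in es (opp ?k), start_in es (opp ?h))"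
  let ?r = "es[i := ?x, j := ?y]"
  have "valence v ?r = valence v es" for v
  proof -
    have "valence v ?r + valence v [es ! j] = valence v (es[i := ?x]) + valence v [?y]"
      using valence_update[of j "es[i := ?x]" v] i j ij by simp
    moreover have "valence v (es[i := ?x]) + valence v [es ! i] = valence v es + valence v [?x]"
      using valence_update[OF i] by simp
    moreover have "valence v [?x] + valence v [?y] = valence v [es ! i] + valence v [es ! j]"
      by (cases "es ! i"; cases "es ! j"; cases b; cases c) (simp_all add: start_in_def opp_def)
    ultimately show ?thesis by linarith
  qed
  moreover have "?x \<in> {Suc 0..n} \<times> {Suc 0..n}" "?y \<in> {Suc 0..n} \<times> {Suc 0..n}"
    using es(1) nth_mem[OF i] nth_mem[OF j] by (auto simp: start_in_def opp_def split_beta)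
  then have "set ?r \<subseteq> {Suc 0..n} \<times> {Suc 0..n}"
    using es(1) set_update_subset_insert[of "es[i := ?x]" j ?y] set_update_subset_insert[of es i ?x]
    by blast
  ultimately show "set ?r \<subseteq> {Suc 0..n} \<times> {Suc 0..n} \<and> (\<forall>v\<in>{Suc 0..n}. 3 \<le> valence v ?r)"
    using es(2) by simp
qed

definition glue_sign :: "half_edge \<Rightarrow> half_edge \<Rightarrow> int" where
  "glue_sign h k = (if snd h then 1 else - 1) * (if snd k then - 1 else 1)"

lemma nverts_simps [simp]:
  "nverts (relabel p X) = nverts X"
  "nverts (reverse_edge i X) = nverts X"
  "nverts (glue h k X) = nverts X"
  by (transfer, auto)+

lemma edges_simps:
  "p permutes {1..nverts X} \<Longrightarrow> edges (relabel p X) = map (map_prod p p) (edges X)"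
  "i < length (edges X) \<Longrightarrow> edges (reverse_edge i X) = (edges X)[i := prod.swap (edges X ! i)]"
  "fst h < length (edges X) \<Longrightarrow> fst k < length (edges X) \<Longrightarrow> fst h \<noteq> fst k \<Longrightarrow>
     edges (glue h k X) = (edges X)[fst h := (start X h, start X k),
                                    fst k := (start X (opp k), start X (opp h))]"
  by (transfer, auto)+

lemma length_edges_simps [simp]:
  "length (edges (relabel p X)) = length (edges X)"
  "length (edges (reverse_edge i X)) = length (edges X)"
  "length (edges (glue h k X)) = length (edges X)"
  by (transfer, auto)+

lemma contract12_simps:
  assumes "i < length (edges X)" "edges X ! i = (1, 2)"
  shows "nverts (contract12 i X) = nverts X - 1"
    and "edges (contract12 i X) = map (map_prod merge12 merge12) (remove_nth i (edges X))"
  using assms by (transfer, auto)+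


subsection \<open>The space of oriented graphs\<close>

definition free_scale :: "'k::field_char_0 \<Rightarrow> ('a \<Rightarrow>\<^sub>0 'k) \<Rightarrow> ('a \<Rightarrow>\<^sub>0 'k)" where
  "free_scale c x = Poly_Mapping.map ((*) c) x"

lemma lookup_free_scale [simp]: "Poly_Mapping.lookup (free_scale c x) a = c * Poly_Mapping.lookup x a"
  by (cases "Poly_Mapping.lookup x a = 0") (simp_all add: free_scale_def Poly_Mapping.map.rep_eq)

interpretation free: vector_space "free_scale :: 'k::field_char_0 \<Rightarrow> ('a \<Rightarrow>\<^sub>0 'k) \<Rightarrow> _"
  by unfold_locales (rule poly_mapping_eqI; simp add: lookup_add algebra_simps)+

definition graph_relations :: "(lgraph \<Rightarrow>\<^sub>0 'k::field_char_0) set" where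
  "graph_relations =
     {Poly_Mapping.single X 1 - Poly_Mapping.single Y 1 | X Y.
        nverts X = nverts Y \<and> mset (edges X) = mset (edges Y)} \<union>
     {Poly_Mapping.single X 1 + Poly_Mapping.single (reverse_edge i X) 1 | X i.
        i < length (edges X)} \<union>
     {Poly_Mapping.single X 1 + Poly_Mapping.single (relabel (transpose p q) X) 1 | X p q.
        p \<in> {1..nverts X} \<and> q \<in> {1..nverts X} \<and> p \<noteq> q}"

definition graph_rel :: "(lgraph \<Rightarrow>\<^sub>0 'k::field_char_0) \<Rightarrow> (lgraph \<Rightarrow>\<^sub>0 'k) \<Rightarrow> bool" where
  "graph_rel x y \<longleftrightarrow> x - y \<in> free.span graph_relations"

lemma equivp_graph_rel: "equivp (graph_rel :: (lgraph \<Rightarrow>\<^sub>0 'k::field_char_0) \<Rightarrow> _)"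
proof (rule equivpI)
  show "reflp (graph_rel :: (lgraph \<Rightarrow>\<^sub>0 'k) \<Rightarrow> _)" by (auto simp: reflp_def graph_rel_def free.span_zero)
  show "symp (graph_rel :: (lgraph \<Rightarrow>\<^sub>0 'k) \<Rightarrow> _)"
    unfolding symp_def graph_rel_def using free.span_neg by (metis minus_diff_eq)
  show "transp (graph_rel :: (lgraph \<Rightarrow>\<^sub>0 'k) \<Rightarrow> _)"
  proof (rule transpI)
    fix x y z :: "lgraph \<Rightarrow>\<^sub>0 'k"
    assume "graph_rel x y" "graph_rel y z"
    then have "(x - y) + (y - z) \<in> free.span graph_relations"
      unfolding graph_rel_def by (rule free.span_add)
    then show "graph_rel x z" by (simp add: graph_rel_def)
  qed
qed

text \<open>
  The space of oriented graphs is a quotient of the free vector space on the labelled graphs: two labelled graphs with the same numbered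
  vertices and the same multiset of directed edges are isomorphic as labelled graphs and hence
  identified, and the other two relations implement $(X,or)=-(X,-or)$.
\<close>

quotient_type (overloaded) 'k graph_space = "lgraph \<Rightarrow>\<^sub>0 'k::field_char_0" / graph_rel
  by (rule equivp_graph_rel)

instantiation graph_space :: (field_char_0) ab_group_add
begin

lift_definition zero_graph_space :: "'a graph_space" is 0 .

lift_definition plus_graph_space :: "'a graph_space \<Rightarrow> 'a graph_space \<Rightarrow> 'a graph_space" is "(+)"
  by (simp add: graph_rel_def add_diff_add free.span_add)

lift_definition uminus_graph_space :: "'a graph_space \<Rightarrow> 'a graph_space" is uminus
  unfolding graph_rel_def using free.span_neg by force

lift_definition minus_graph_space :: "'a graph_space \<Rightarrow> 'a graph_space \<Rightarrow> 'a graph_space" is "(-)"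
proof -
  fix a b c d :: "lgraph \<Rightarrow>\<^sub>0 'a"
  assume "graph_rel a b" "graph_rel c d"
  then have "(a - b) - (c - d) \<in> free.span graph_relations"
    unfolding graph_rel_def by (rule free.span_diff)
  then show "graph_rel (a - c) (b - d)" by (simp add: graph_rel_def algebra_simps)
qed

instance
  by standard (transfer, simp add: graph_rel_def free.span_zero algebra_simps)+

end

lift_definition scale :: "'k::field_char_0 \<Rightarrow> 'k graph_space \<Rightarrow> 'k graph_space" (infixr "*\<^sub>G" 75)
  is free_scale
  unfolding graph_rel_def by (metis free.scale_right_diff_distrib free.span_scale)

interpretation gs: vector_space "scale :: 'k::field_char_0 \<Rightarrow> _"
proof -
  have refl: "x = y \<Longrightarrow> graph_rel x y" for x y :: "lgraph \<Rightarrow>\<^sub>0 'k"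
    by (simp add: graph_rel_def free.span_zero)
  show "vector_space (scale :: 'k \<Rightarrow> _)"
    by standard (transfer, rule refl, simp add: free.scale_right_distrib free.scale_left_distrib)+
qed

definition gr :: "lgraph \<Rightarrow> 'k::field_char_0 graph_space" where
  "gr X = abs_graph_space (Poly_Mapping.single X 1)"

lemma gr_mset:
  assumes "nverts X = nverts Y" "mset (edges X) = mset (edges Y)"
  shows "gr X = (gr Y :: 'k::field_char_0 graph_space)"
proof -
  have "(Poly_Mapping.single X 1 - Poly_Mapping.single Y 1 :: lgraph \<Rightarrow>\<^sub>0 'k) \<in> graph_relations"
    using assms unfolding graph_relations_def by blast
  then show ?thesis
    by (simp add: gr_def graph_space.abs_eq_iff graph_rel_def free.span_base)
qed

lemma gr_reverse:
  assumes "i < length (edges X)"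
  shows "gr (reverse_edge i X) = - (gr X :: 'k::field_char_0 graph_space)"
proof -
  have "(Poly_Mapping.single X 1 + Poly_Mapping.single (reverse_edge i X) 1 :: lgraph \<Rightarrow>\<^sub>0 'k)
      \<in> graph_relations"
    using assms unfolding graph_relations_def by blast
  then have "gr X + gr (reverse_edge i X) = (0 :: 'k graph_space)"
    by (simp add: gr_def plus_graph_space.abs_eq zero_graph_space_def graph_space.abs_eq_iff
        graph_rel_def free.span_base)
  then show ?thesis by (metis minus_unique)
qed

lemma gr_transpose:
  assumes "p \<in> {1..nverts X}" "q \<in> {1..nverts X}" "p \<noteq> q"
  shows "gr (relabel (transpose p q) X) = - (gr X :: 'k::field_char_0 graph_space)"
proof -
  have "(Poly_Mapping.single X 1 + Poly_Mapping.single (relabel (transpose p q) X) 1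
      :: lgraph \<Rightarrow>\<^sub>0 'k) \<in> graph_relations"
    using assms unfolding graph_relations_def by blast
  then have "gr X + gr (relabel (transpose p q) X) = (0 :: 'k graph_space)"
    by (simp add: gr_def plus_graph_space.abs_eq zero_graph_space_def graph_space.abs_eq_iff
        graph_rel_def free.span_base)
  then show ?thesis by (metis minus_unique)
qed

definition lin_ext :: "(lgraph \<Rightarrow> 'k::field_char_0 graph_space) \<Rightarrow> (lgraph \<Rightarrow>\<^sub>0 'k) \<Rightarrow> 'k graph_space"
  where "lin_ext F x = (\<Sum>X\<in>Poly_Mapping.keys x. Poly_Mapping.lookup x X *\<^sub>G F X)"

definition respects_relations :: "(lgraph \<Rightarrow> 'k::field_char_0 graph_space) \<Rightarrow> bool" where
  "respects_relations F \<longleftrightarrow>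
     (\<forall>X Y. nverts X = nverts Y \<longrightarrow> mset (edges X) = mset (edges Y) \<longrightarrow> F X = F Y) \<and>
     (\<forall>X i. i < length (edges X) \<longrightarrow> F (reverse_edge i X) = - F X) \<and>
     (\<forall>X p q. p \<in> {1..nverts X} \<longrightarrow> q \<in> {1..nverts X} \<longrightarrow> p \<noteq> q \<longrightarrow>
        F (relabel (transpose p q) X) = - F X)"

lemma lin_ext_superset:
  "finite A \<Longrightarrow> Poly_Mapping.keys x \<subseteq> A \<Longrightarrow> lin_ext F x = (\<Sum>X\<in>A. Poly_Mapping.lookup x X *\<^sub>G F X)"
  unfolding lin_ext_def
  by (rule sum.mono_neutral_left) (simp_all add: in_keys_iff)

lemma lin_ext_add: "lin_ext F (x + y) = lin_ext F x + lin_ext F y"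
proof -
  let ?A = "Poly_Mapping.keys x \<union> Poly_Mapping.keys y"
  have "Poly_Mapping.keys (x + y) \<subseteq> ?A" by (rule keys_add)
  then show ?thesis
    by (simp add: lin_ext_superset[of ?A] lookup_add gs.scale_left_distrib sum.distrib)
qed

lemma lin_ext_scale: "lin_ext F (free_scale c x) = c *\<^sub>G lin_ext F x"
proof -
  have "Poly_Mapping.keys (free_scale c x) \<subseteq> Poly_Mapping.keys x" by (auto simp: in_keys_iff)
  then show ?thesis
    by (simp add: lin_ext_superset[of "Poly_Mapping.keys x"] gs.scale_sum_right)
qed

lemma lin_ext_single [simp]: "lin_ext F (Poly_Mapping.single X 1) = F X"
  by (simp add: lin_ext_def)

lemma lin_ext_diff: "lin_ext F (x - y) = lin_ext F x - lin_ext F y"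
  using lin_ext_add[of F "x - y" y] by simp

lemma lin_ext_respects:
  assumes "respects_relations F" "graph_rel x y"
  shows "lin_ext F x = lin_ext F y"
proof -
  have "lin_ext F z = 0" if "z \<in> free.span graph_relations" for z
    using that
  proof (induction rule: free.span_induct_alt)
    case base
    then show ?case by (simp add: lin_ext_def)
  next
    case (step c r z)
    from step(1) consider
      X Y where "r = Poly_Mapping.single X 1 - Poly_Mapping.single Y 1"
        "nverts X = nverts Y" "mset (edges X) = mset (edges Y)"
    | X i where "r = Poly_Mapping.single X 1 + Poly_Mapping.single (reverse_edge i X) 1"
        "i < length (edges X)"
    | X p q where "r = Poly_Mapping.single X 1 + Poly_Mapping.single (relabel (transpose p q) X) 1"
        "p \<in> {1..nverts X}" "q \<in> {1..nverts X}" "p \<noteq> q"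
      unfolding graph_relations_def by blast
    then have "lin_ext F r = 0"
    proof cases
      case 1
      then have "F X = F Y" using assms(1) unfolding respects_relations_def by blast
      with 1(1) show ?thesis by (simp add: lin_ext_diff)
    next
      case 2
      then have "F (reverse_edge i X) = - F X"
        using assms(1) unfolding respects_relations_def by blast
      with 2(1) show ?thesis by (simp add: lin_ext_add)
    next
      case 3
      then have "F (relabel (transpose p q) X) = - F X"
        using assms(1) unfolding respects_relations_def by blast
      with 3(1) show ?thesis by (simp add: lin_ext_add)
    qed
    then show ?case using step by (simp add: lin_ext_add lin_ext_scale)
  qed
  then have "lin_ext F (x - y) = 0" using assms(2) by (simp add: graph_rel_def)
  then show ?thesis by (simp add: lin_ext_diff)
qed


subsection \<open>Collapsing edges\<close>

declare One_nat_def [simp del]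

lemma relabel_id [simp]: "relabel id X = X"
  by (rule lgraph_eqI) (simp_all add: edges_simps permutes_id map_prod.id)

lemma relabel_comp:
  assumes "p permutes {1..nverts X}" "q permutes {1..nverts X}"
  shows "relabel p (relabel q X) = relabel (p \<circ> q) X"
  using assms by (intro lgraph_eqI) (auto simp: edges_simps permutes_compose)

lemma map_remove_nth: "map f (remove_nth i xs) = remove_nth i (map f xs)"
  by (simp add: remove_nth_def take_map drop_map)

lemma set_remove_nth: "set (remove_nth i xs) \<subseteq> set xs"
  by (auto simp: remove_nth_def dest: in_set_takeD in_set_dropD)

definition bring12 :: "nat \<Rightarrow> nat \<Rightarrow> nat \<Rightarrow> nat" where
  "bring12 a b = transpose 2 (transpose 1 a b) \<circ> transpose 1 a"

lemma bring12:
  assumes "a \<in> {1..n}" "b \<in> {1..n}" "a \<noteq> b"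
  shows "bring12 a b permutes {1..n}" "bring12 a b a = 1" "bring12 a b b = 2"
proof -
  have "transpose 1 a b \<in> {1..n}" using assms by (auto simp: transpose_def)
  moreover have "2 \<in> {1..n}" "1 \<in> {1..n}" using assms by auto
  ultimately show "bring12 a b permutes {1..n}"
    unfolding bring12_def using assms by (intro permutes_compose permutes_swap_id)
  show "bring12 a b a = 1" "bring12 a b b = 2"
    using assms unfolding bring12_def by (auto simp: transpose_def)
qed

text \<open>
  $X_e$ for the edge \<open>e\<close> with index \<open>i\<close>, where \<open>e\<close> is not a loop.  The permutation \<open>bring12 a b\<close> of
  the vertex numbers produces a labelling in which \<open>e\<close> runs from 1 to 2; its sign compares the
  orientation of that labelling with the given one.  Any other such permutation gives the same
  result, see \<open>collapse_eq\<close>.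
\<close>

definition collapse :: "nat \<Rightarrow> lgraph \<Rightarrow> 'k::field_char_0 graph_space" where
  "collapse i X = (let (a, b) = edges X ! i; p = bring12 a b
     in of_int (sign p) *\<^sub>G gr (contract12 i (relabel p X)))"

lemma collapse_pair:
  "edges X ! i = (a, b) \<Longrightarrow> collapse i X =
    of_int (sign (bring12 a b)) *\<^sub>G gr (contract12 i (relabel (bring12 a b) X))"
  by (simp add: collapse_def Let_def)

lemma contract12_transpose:
  assumes i: "i < length (edges X)" "edges X ! i = (1, 2)"
    and ab: "a \<in> {3..nverts X}" "b \<in> {3..nverts X}" "a \<noteq> b"
  shows "contract12 i (relabel (transpose a b) X) = relabel (transpose (a - 1) (b - 1)) (contract12 i X)"
proof -
  have p: "transpose a b permutes {1..nverts X}"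
    using ab by (intro permutes_swap_id) auto
  have i': "edges (relabel (transpose a b) X) ! i = (1, 2)"
    using i ab by (simp add: edges_simps p transpose_def)
  have q: "transpose (a - 1) (b - 1) permutes {1..nverts X - 1}"
    using ab by (intro permutes_swap_id) auto
  have m: "merge12 (transpose a b x) = transpose (a - 1) (b - 1) (merge12 x)" if "1 \<le> x" for x
    using that ab by (auto simp: merge12_def transpose_def)
  show ?thesis
  proof (rule lgraph_eqI)
    show "edges (contract12 i (relabel (transpose a b) X)) =
        edges (relabel (transpose (a - 1) (b - 1)) (contract12 i X))"
      using set_remove_nth[of i "edges X"] set_edges[of X] i i' p q
      by (auto simp: contract12_simps edges_simps simp flip: map_remove_nth intro!: m)
  qed (use i i' in \<open>simp add: contract12_simps\<close>)
qed

lemma contract12_relabel: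
  assumes r: "r permutes {3..nverts X}" and i: "i < length (edges X)" "edges X ! i = (1, 2)"
  shows "gr (contract12 i (relabel r X)) =
    of_int (sign r) *\<^sub>G (gr (contract12 i X) :: 'k::field_char_0 graph_space)"
  using r finite_atLeastAtMost
proof (induction rule: permutes_induct)
  case id
  show ?case unfolding relabel_id sign_id by simp
next
  case (swap a b p)
  have p: "p permutes {1..nverts X}"
    using swap.hyps(4) by (rule permutes_subset) auto
  have t: "transpose a b permutes {1..nverts X}"
    using swap.hyps by (intro permutes_swap_id) auto
  let ?Z = "relabel p X"
  have "p 1 = 1" "p 2 = 2" using swap.hyps(4) by (auto simp: permutes_def)
  then have Z: "i < length (edges ?Z)" "edges ?Z ! i = (1, 2)"
    using i p by (simp_all add: edges_simps)
  have "gr (contract12 i (relabel (transpose a b \<circ> p) X)) =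
      (gr (relabel (transpose (a - 1) (b - 1)) (contract12 i ?Z)) :: 'k graph_space)"
    using contract12_transpose[OF Z, of a b] swap.hyps by (simp add: relabel_comp[OF t p])
  also have "\<dots> = - gr (contract12 i ?Z)"
    using swap.hyps by (intro gr_transpose) (auto simp: contract12_simps[OF Z])
  also have "\<dots> = of_int (sign (transpose a b \<circ> p)) *\<^sub>G gr (contract12 i X)"
  proof -
    have "permutation p" using p by (auto simp: permutation_permutes)
    then have "sign (transpose a b \<circ> p) = - sign p"
      using swap.hyps(3) by (simp add: sign_compose permutation_swap_id sign_swap_id)
    then show ?thesis by (simp add: swap.IH)
  qed
  finally show ?case .
qed

lemma collapse_eq:
  assumes p: "p permutes {1..nverts X}" and i: "i < length (edges X)" "edges X ! i = (a, b)"
    and pab: "p a = 1" "p b = 2"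
  shows "collapse i X = of_int (sign p) *\<^sub>G (gr (contract12 i (relabel p X)) :: 'k::field_char_0 graph_space)"
proof -
  let ?n = "nverts X"
  define q where "q = bring12 a b"
  have ab: "a \<in> {1..?n}" "b \<in> {1..?n}" "a \<noteq> b"
    using edges_range[OF i(1)] i(2) pab by auto
  note q = bring12[OF ab, folded q_def]
  define r where "r = p \<circ> inv q"
  have rn: "r permutes {1..?n}"
    unfolding r_def using p q(1) by (intro permutes_compose permutes_inv)
  have r12: "r 1 = 1" "r 2 = 2"
    unfolding r_def using q pab by (metis comp_apply permutes_inverses(2))+
  have r: "r permutes {3..?n}"
  proof (rule permutes_superset[OF rn])
    fix x assume "x \<in> {1..?n} - {3..?n}"
    then have "x = 1 \<or> x = 2" by auto
    then show "r x = x" using r12 by auto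
  qed
  have prq: "p = r \<circ> q"
    unfolding r_def using permutes_inv_o(2)[OF q(1)] by (simp add: comp_assoc)
  have "permutation r" "permutation q"
    using rn q(1) by (auto simp: permutation_permutes)
  then have sgn: "sign p = sign r * sign q" by (simp add: prq sign_compose)
  have Z: "i < length (edges (relabel q X))" "edges (relabel q X) ! i = (1, 2)"
    using i q by (simp_all add: edges_simps)
  have "gr (contract12 i (relabel p X)) =
      of_int (sign r) *\<^sub>G (gr (contract12 i (relabel q X)) :: 'k graph_space)"
    using contract12_relabel[OF _ Z, of r] r relabel_comp[OF rn q(1)] by (simp add: prq)
  moreover have "of_int (sign p) * of_int (sign r) = (of_int (sign q) :: 'k)"
    unfolding sgn by (metis mult.assoc mult.commute mult_1 of_int_1 of_int_mult sign_idempotent)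
  ultimately show ?thesis
    by (simp add: collapse_def i(2) q_def[symmetric])
qed

lemma collapse_relabel:
  assumes t: "t permutes {1..nverts X}" and i: "i < length (edges X)"
    and ne: "fst (edges X ! i) \<noteq> snd (edges X ! i)"
  shows "collapse i (relabel t X) = of_int (sign t) *\<^sub>G (collapse i X :: 'k::field_char_0 graph_space)"
proof -
  obtain a b where e: "edges X ! i = (a, b)" by force
  have ab: "a \<in> {1..nverts X}" "b \<in> {1..nverts X}" "a \<noteq> b"
    using edges_range[OF i] e ne by auto
  define q where "q = bring12 a b"
  note q = bring12[OF ab, folded q_def]
  define p where "p = q \<circ> inv t"
  have p: "p permutes {1..nverts X}"
    unfolding p_def using q(1) t by (intro permutes_compose permutes_inv)
  have pt: "p \<circ> t = q"
    unfolding p_def using permutes_inv_o(2)[OF t] by (simp add: comp_assoc)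
  have et: "edges (relabel t X) ! i = (t a, t b)"
    using i e t by (simp add: edges_simps)
  have "p (t a) = 1" "p (t b) = 2" using pt q(2,3) by (auto simp: fun_eq_iff)
  then have "collapse i (relabel t X) =
      of_int (sign p) *\<^sub>G (gr (contract12 i (relabel p (relabel t X))) :: 'k graph_space)"
    using p i et by (intro collapse_eq) simp_all
  also have "relabel p (relabel t X) = relabel q X"
    using relabel_comp[OF p t] pt by simp
  also have "sign p = sign t * sign q"
  proof -
    have "permutation t" "permutation p" using p t by (auto simp: permutation_permutes)
    then have "sign q = sign p * sign t" by (simp flip: pt add: sign_compose)
    then show ?thesis by (simp add: mult.commute)
  qed
  finally show ?thesis
    using e by (simp add: collapse_def q_def[symmetric])
qed

lemma remove_nth_update:
  "remove_nth i (xs[i := x]) = remove_nth i xs"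
  by (simp add: remove_nth_def)

lemma mset_remove_nth: "i < length xs \<Longrightarrow> mset (remove_nth i xs) = mset xs - {#xs ! i#}"
  by (metis add_mset_remove_trivial id_take_nth_drop mset.simps(2) mset_append remove_nth_def
      union_mset_add_mset_right)

lemma collapse_mset:
  assumes n: "nverts X = nverts Y" and m: "mset (edges X) = mset (edges Y)"
    and i: "i < length (edges X)" and j: "j < length (edges Y)"
    and e: "edges X ! i = edges Y ! j" and ne: "fst (edges X ! i) \<noteq> snd (edges X ! i)"
  shows "collapse i X = (collapse j Y :: 'k::field_char_0 graph_space)"
proof -
  obtain a b where ab: "edges X ! i = (a, b)" by force
  then have eY: "edges Y ! j = (a, b)" using e by simp
  have "a \<in> {1..nverts X}" "b \<in> {1..nverts X}" "a \<noteq> b"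
    using edges_range[OF i] ab ne by auto
  note q = bring12[OF this]
  let ?q = "bring12 a b"
  have X: "edges (relabel ?q X) ! i = (1, 2)" and Y: "edges (relabel ?q Y) ! j = (1, 2)"
    using q i j eY ab n by (simp_all add: edges_simps)
  have "gr (contract12 i (relabel ?q X)) = (gr (contract12 j (relabel ?q Y)) :: 'k graph_space)"
  proof (rule gr_mset)
    show "nverts (contract12 i (relabel ?q X)) = nverts (contract12 j (relabel ?q Y))"
      using X Y i j n by (simp add: contract12_simps)
    have "mset (remove_nth i (map (map_prod ?q ?q) (edges X))) =
        mset (remove_nth j (map (map_prod ?q ?q) (edges Y)))"
      using i j e m by (simp add: mset_remove_nth)
    then show "mset (edges (contract12 i (relabel ?q X))) = mset (edges (contract12 j (relabel ?q Y)))"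
      using X Y i j n q(1) by (simp add: contract12_simps edges_simps)
  qed
  then show ?thesis using ab e by (simp add: collapse_def)
qed

lemma collapse_reverse_same:
  assumes i: "i < length (edges X)" and ne: "fst (edges X ! i) \<noteq> snd (edges X ! i)"
  shows "collapse i (reverse_edge i X) = - (collapse i X :: 'k::field_char_0 graph_space)"
proof -
  obtain a b where ab: "edges X ! i = (a, b)" by force
  have r: "a \<in> {1..nverts X}" "b \<in> {1..nverts X}" "a \<noteq> b"
    using edges_range[OF i] ab ne by auto
  note q = bring12[OF this]
  let ?q = "bring12 a b"
  have n: "2 \<le> nverts X" using r by auto
  define p where "p = transpose 1 2 \<circ> ?q"
  have t: "transpose 1 2 permutes {1..nverts X}" using n by (intro permutes_swap_id) auto
  have p: "p permutes {1..nverts X}"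
    unfolding p_def using q(1) t by (rule permutes_compose)
  have pab: "p a = 2" "p b = 1" unfolding p_def using q by simp_all
  have "permutation ?q" using q(1) by (auto simp: permutation_permutes)
  then have sgn: "sign p = - sign ?q"
    unfolding p_def by (simp add: sign_compose permutation_swap_id sign_swap_id)
  have X: "edges (relabel ?q X) ! i = (1, 2)"
    using q i ab by (simp add: edges_simps)
  have Y: "edges (relabel p (reverse_edge i X)) ! i = (1, 2)"
    using p pab i ab by (simp add: edges_simps)
  have mp: "merge12 (p x) = merge12 (?q x)" for x
    by (auto simp: p_def merge12_def transpose_def)
  have "contract12 i (relabel p (reverse_edge i X)) = contract12 i (relabel ?q X)"
  proof (rule lgraph_eqI)
    show "nverts (contract12 i (relabel p (reverse_edge i X))) = nverts (contract12 i (relabel ?q X))"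
      using X Y i by (simp add: contract12_simps)
    show "edges (contract12 i (relabel p (reverse_edge i X))) = edges (contract12 i (relabel ?q X))"
      using X Y i p q(1)
      by (simp add: contract12_simps edges_simps remove_nth_update mp prod_eq_iff flip: map_remove_nth)
  qed
  then have "collapse i (reverse_edge i X) = of_int (sign p) *\<^sub>G
      (gr (contract12 i (relabel ?q X)) :: 'k graph_space)"
    using p pab i ab by (subst collapse_eq[of p _ _ b a]) (simp_all add: edges_simps)
  then show ?thesis using ab sgn by (simp add: collapse_pair)
qed

lemma remove_nth_nth:
  assumes "i < length xs" "k < length xs - 1"
  shows "remove_nth i xs ! k = (if k < i then xs ! k else xs ! Suc k)"
  using assms by (auto simp: remove_nth_def nth_append min_def)

lemma length_remove_nth: "i < length xs \<Longrightarrow> length (remove_nth i xs) = length xs - 1"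
  by (simp add: remove_nth_def)

lemma remove_nth_update_other:
  assumes "i \<noteq> j" "i < length xs" "j < length xs"
  shows "remove_nth i (xs[j := x]) = (remove_nth i xs)[(if j < i then j else j - 1) := x]"
proof (rule nth_equalityI)
  fix k assume "k < length (remove_nth i (xs[j := x]))"
  then have "k < length xs - 1" using assms by (simp add: length_remove_nth)
  then show "remove_nth i (xs[j := x]) ! k = (remove_nth i xs)[(if j < i then j else j - 1) := x] ! k"
    using assms by (cases "j < i") (auto simp: remove_nth_nth nth_list_update length_remove_nth)
qed (use assms in \<open>simp add: length_remove_nth\<close>)

lemma nth_remove_nth:
  assumes "i \<noteq> j" "i < length xs" "j < length xs"
  shows "remove_nth i xs ! (if j < i then j else j - 1) = xs ! j"
    "(if j < i then j else j - 1) < length (remove_nth i xs)"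
  using assms by (auto simp: remove_nth_def nth_append min_def)

lemma collapse_reverse_other:
  assumes i: "i < length (edges X)" and j: "j < length (edges X)" and ij: "i \<noteq> j"
    and ne: "fst (edges X ! i) \<noteq> snd (edges X ! i)"
  shows "collapse i (reverse_edge j X) = - (collapse i X :: 'k::field_char_0 graph_space)"
proof -
  obtain a b where ab: "edges X ! i = (a, b)" by force
  have "a \<in> {1..nverts X}" "b \<in> {1..nverts X}" "a \<noteq> b"
    using edges_range[OF i] ab ne by auto
  note q = bring12[OF this]
  let ?q = "bring12 a b" and ?j = "if j < i then j else j - 1"
  have X: "edges (relabel ?q X) ! i = (1, 2)"
    using q i ab by (simp add: edges_simps)
  have Y: "edges (relabel ?q (reverse_edge j X)) ! i = (1, 2)"
    using q i j ij ab by (simp add: edges_simps)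
  let ?Z = "contract12 i (relabel ?q X)"
  have jl: "?j < length (edges ?Z)"
    using nth_remove_nth(2)[OF ij i j] X i q(1)
    by (simp add: contract12_simps edges_simps flip: map_remove_nth)
  have "contract12 i (relabel ?q (reverse_edge j X)) = reverse_edge ?j ?Z"
  proof (rule lgraph_eqI)
    show "nverts (contract12 i (relabel ?q (reverse_edge j X))) = nverts (reverse_edge ?j ?Z)"
      using X Y i by (simp add: contract12_simps)
    show "edges (contract12 i (relabel ?q (reverse_edge j X))) = edges (reverse_edge ?j ?Z)"
      unfolding edges_simps(2)[OF jl]
      using X Y i j ij q(1) nth_remove_nth[OF ij i j]
      by (simp add: contract12_simps edges_simps remove_nth_update_other map_update prod.swap_def
          flip: map_remove_nth)
  qed
  then have "gr (contract12 i (relabel ?q (reverse_edge j X))) = - (gr ?Z :: 'k graph_space)"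
    using gr_reverse[OF jl] by simp
  then show ?thesis
    using ab ij j by (simp add: collapse_pair edges_simps)
qed

lemma collapse_reverse:
  assumes "i < length (edges X)" "j < length (edges X)" "fst (edges X ! i) \<noteq> snd (edges X ! i)"
  shows "collapse i (reverse_edge j X) = - (collapse i X :: 'k::field_char_0 graph_space)"
  using assms collapse_reverse_same collapse_reverse_other by (cases "i = j") auto

lemma gr_loop:
  assumes i: "i < length (edges X)" and loop: "fst (edges X ! i) = snd (edges X ! i)"
  shows "gr X = (0 :: 'k::field_char_0 graph_space)"
proof -
  have "prod.swap (edges X ! i) = edges X ! i"
    using loop by (simp add: prod_eq_iff)
  then have "reverse_edge i X = X"
    using i by (intro lgraph_eqI) (simp_all add: edges_simps)
  then have "gr X = - (gr X :: 'k graph_space)"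
    using gr_reverse[OF i, where 'k = 'k] by simp
  then have "gr X + gr X = (0 :: 'k graph_space)"
    by (metis add.right_inverse)
  then have "(1 + 1) *\<^sub>G gr X = (0 :: 'k graph_space)"
    by (simp only: gs.scale_left_distrib gs.scale_one)
  then show ?thesis by (subst (asm) gs.scale_eq_0_iff) simp
qed

text \<open>
  A loop of \<open>X\<close> cannot be collapsed and is left out of the sum; a graph with a loop is zero in
  \<open>graph_space\<close> by \<open>gr_loop\<close>.
\<close>

definition dE_gen :: "lgraph \<Rightarrow> 'k::field_char_0 graph_space" where
  "dE_gen X = (\<Sum>i | i < length (edges X) \<and> fst (edges X ! i) \<noteq> snd (edges X ! i). collapse i X)"

lemma dE_gen_respects: "respects_relations (dE_gen :: lgraph \<Rightarrow> 'k::field_char_0 graph_space)"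
  unfolding respects_relations_def
proof (intro conjI allI impI)
  fix X Y assume n: "nverts X = nverts Y" and m: "mset (edges X) = mset (edges Y)"
  obtain s where s: "s permutes {..<length (edges Y)}" "permute_list s (edges Y) = edges X"
    using mset_eq_permutation[OF m] by blast
  have len: "length (edges X) = length (edges Y)" using m by (rule mset_eq_length)
  have nth: "edges X ! i = edges Y ! s i" if "i < length (edges X)" for i
    using s that len permute_list_nth[OF s(1)] by force
  have lt: "s i < length (edges Y) \<longleftrightarrow> i < length (edges Y)" for i
    using permutes_in_image[OF s(1), of i] by simp
  show "dE_gen X = (dE_gen Y :: 'k graph_space)"
    unfolding dE_gen_def
  proof (rule sum.reindex_bij_witness[of _ "inv s" s])
    fix i assume "i \<in> {i. i < length (edges X) \<and> fst (edges X ! i) \<noteq> snd (edges X ! i)}"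
    then have i: "i < length (edges X)" "fst (edges X ! i) \<noteq> snd (edges X ! i)" by auto
    show "inv s (s i) = i" using s(1) by (rule permutes_inverses(2))
    show "s i \<in> {i. i < length (edges Y) \<and> fst (edges Y ! i) \<noteq> snd (edges Y ! i)}"
      using i nth lt len by auto
    show "collapse (s i) Y = (collapse i X :: 'k graph_space)"
      using i nth lt len by (intro collapse_mset[symmetric] n m) auto
  next
    fix j assume "j \<in> {i. i < length (edges Y) \<and> fst (edges Y ! i) \<noteq> snd (edges Y ! i)}"
    then show "s (inv s j) = j"
      and "inv s j \<in> {i. i < length (edges X) \<and> fst (edges X ! i) \<noteq> snd (edges X ! i)}"
      using nth[of "inv s j"] lt[of "inv s j"] len permutes_inverses(1)[OF s(1)] by auto
  qed
next
  fix X i assume i: "i < length (edges X)"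
  have "fst (edges (reverse_edge i X) ! j) \<noteq> snd (edges (reverse_edge i X) ! j) \<longleftrightarrow>
      fst (edges X ! j) \<noteq> snd (edges X ! j)" if "j < length (edges X)" for j
    using that i by (cases "i = j") (auto simp: edges_simps)
  then have "{j. j < length (edges (reverse_edge i X)) \<and>
      fst (edges (reverse_edge i X) ! j) \<noteq> snd (edges (reverse_edge i X) ! j)} =
      {j. j < length (edges X) \<and> fst (edges X ! j) \<noteq> snd (edges X ! j)}"
    by auto
  then show "dE_gen (reverse_edge i X) = - (dE_gen X :: 'k graph_space)"
    unfolding dE_gen_def by (simp add: collapse_reverse i flip: sum_negf)
next
  fix X p q assume pq: "p \<in> {1..nverts X}" "q \<in> {1..nverts X}" "p \<noteq> (q :: nat)"
  then have t: "transpose p q permutes {1..nverts X}" by (intro permutes_swap_id)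
  have "fst (edges (relabel (transpose p q) X) ! j) \<noteq> snd (edges (relabel (transpose p q) X) ! j) \<longleftrightarrow>
      fst (edges X ! j) \<noteq> snd (edges X ! j)" if "j < length (edges X)" for j
    using that t permutes_inj[OF t] by (simp add: edges_simps inj_eq)
  then have "{j. j < length (edges (relabel (transpose p q) X)) \<and>
      fst (edges (relabel (transpose p q) X) ! j) \<noteq> snd (edges (relabel (transpose p q) X) ! j)} =
      {j. j < length (edges X) \<and> fst (edges X ! j) \<noteq> snd (edges X ! j)}"
    by auto
  then show "dE_gen (relabel (transpose p q) X) = - (dE_gen X :: 'k graph_space)"
    unfolding dE_gen_def
    by (simp add: collapse_relabel[OF t] sign_swap_id pq flip: sum_negf)
qed


subsection \<open>Cutting and gluing\<close>

text \<open>
  $X_{hk}$, for half-edges \<open>h\<close>, \<open>k\<close> of \<open>X\<close> lying in different edges; the edge \<open>h \<union> k\<close> of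
  \<open>glue h k X\<close> has index \<open>fst h\<close>.
\<close>

definition glue_collapse :: "half_edge \<Rightarrow> half_edge \<Rightarrow> lgraph \<Rightarrow> 'k::field_char_0 graph_space" where
  "glue_collapse h k X = (if start X h = start X k then 0
     else of_int (glue_sign h k) *\<^sub>G collapse (fst h) (glue h k X))"

definition flip_at :: "nat \<Rightarrow> half_edge \<Rightarrow> half_edge" where
  "flip_at j h = (if fst h = j then opp h else h)"

lemma opp_simps [simp]: "fst (opp h) = fst h" "snd (opp h) = (\<not> snd h)" "opp (opp h) = h"
  by (simp_all add: opp_def)

lemma flip_at_simps [simp]:
  "fst (flip_at j h) = fst h" "flip_at j (flip_at j h) = h" "opp (flip_at j h) = flip_at j (opp h)"
  by (simp_all add: flip_at_def)

lemma half_edges_iff: "h \<in> half_edges X \<longleftrightarrow> fst h < length (edges X)"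
  by (cases h) (simp add: half_edges_def)

lemma start_reverse:
  "j < length (edges X) \<Longrightarrow> fst h < length (edges X) \<Longrightarrow> start (reverse_edge j X) h = start X (flip_at j h)"
  by (simp add: start_in_def flip_at_def edges_simps)

lemma start_relabel:
  "p permutes {1..nverts X} \<Longrightarrow> fst h < length (edges X) \<Longrightarrow> start (relabel p X) h = p (start X h)"
  by (simp add: start_in_def edges_simps)

lemma nth_glue:
  assumes "fst h < length (edges X)" "fst k < length (edges X)" "fst h \<noteq> fst k"
  shows "edges (glue h k X) ! fst h = (start X h, start X k)"
    and "edges (glue h k X) ! fst k = (start X (opp k), start X (opp h))"
  using assms by (simp_all add: edges_simps)

lemma glue_collapse_relabel:
  assumes t: "t permutes {1..nverts X}"
    and hk: "fst h < length (edges X)" "fst k < length (edges X)" "fst h \<noteq> fst k"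
  shows "glue_collapse h k (relabel t X) =
    of_int (sign t) *\<^sub>G (glue_collapse h k X :: 'k::field_char_0 graph_space)"
proof (cases "start X h = start X k")
  case True
  then show ?thesis using t hk by (simp add: glue_collapse_def start_relabel)
next
  case False
  then have "start (relabel t X) h \<noteq> start (relabel t X) k"
    using t hk by (simp add: start_relabel permutes_inj inj_eq)
  moreover have "glue h k (relabel t X) = relabel t (glue h k X)"
  proof (rule lgraph_eqI)
    show "edges (glue h k (relabel t X)) = edges (relabel t (glue h k X))"
      using t hk by (simp add: edges_simps(3) start_relabel) (simp add: edges_simps map_update)
  qed simp
  moreover have "collapse (fst h) (relabel t (glue h k X)) =
      of_int (sign t) *\<^sub>G (collapse (fst h) (glue h k X) :: 'k graph_space)"
    using t hk False by (intro collapse_relabel) (simp_all add: nth_glue)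
  ultimately show ?thesis
    using False by (simp add: glue_collapse_def mult.commute)
qed

lemma list_update_overwrite2: "i \<noteq> j \<Longrightarrow> xs[j := x, i := y, j := z] = xs[i := y, j := z]"
  by (metis list_update_overwrite list_update_swap)

lemma glue_collapse_reverse:
  assumes j: "j < length (edges X)"
    and hk: "fst h < length (edges X)" "fst k < length (edges X)" "fst h \<noteq> fst k"
  shows "glue_collapse h k (reverse_edge j X) =
    - (glue_collapse (flip_at j h) (flip_at j k) X :: 'k::field_char_0 graph_space)"
proof -
  let ?h = "flip_at j h" and ?k = "flip_at j k"
  have st: "start (reverse_edge j X) h = start X ?h" "start (reverse_edge j X) k = start X ?k"
    using j hk by (simp_all add: start_reverse)
  have e: "edges (glue h k (reverse_edge j X)) =
      (edges X)[j := prod.swap (edges X ! j), fst h := (start X ?h, start X ?k),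
                fst k := (start X (opp ?k), start X (opp ?h))]"
    using j hk by (simp add: edges_simps(3) start_reverse) (simp add: edges_simps(2))
  show ?thesis
  proof (cases "start X ?h = start X ?k")
    case True
    then show ?thesis by (simp add: glue_collapse_def st)
  next
    case ne: False
    show ?thesis
    proof (cases "j = fst h \<or> j = fst k")
      case True
      have "glue h k (reverse_edge j X) = glue ?h ?k X"
        using True j hk
        by (intro lgraph_eqI) (auto simp: e edges_simps(3) list_update_overwrite2)
      moreover have "glue_sign h k = - glue_sign ?h ?k"
        using True hk(3) by (auto simp: glue_sign_def flip_at_def)
      ultimately show ?thesis using ne by (simp add: glue_collapse_def st)
    next
      case False
      then have eq: "?h = h" "?k = k" by (auto simp: flip_at_def)
      have "glue h k (reverse_edge j X) = reverse_edge j (glue h k X)"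
        using False j hk eq
        by (intro lgraph_eqI) (auto simp: e edges_simps flip_at_def list_update_swap)
      moreover have "collapse (fst h) (reverse_edge j (glue h k X)) =
          - (collapse (fst h) (glue h k X) :: 'k graph_space)"
        using j hk ne eq by (intro collapse_reverse) (simp_all add: nth_glue)
      ultimately show ?thesis using ne eq by (simp add: glue_collapse_def st)
    qed
  qed
qed

lemma glue_collapse_mset:
  assumes n: "nverts X = nverts Y" and s: "s permutes {..<length (edges Y)}"
    "permute_list s (edges Y) = edges X"
    and hk: "fst h < length (edges X)" "fst k < length (edges X)" "fst h \<noteq> fst k"
  shows "glue_collapse h k X =
    (glue_collapse (s (fst h), snd h) (s (fst k), snd k) Y :: 'k::field_char_0 graph_space)"
proof -
  let ?h = "(s (fst h), snd h)" and ?k = "(s (fst k), snd k)"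
  have len: "length (edges X) = length (edges Y)" using s(2) by (metis length_permute_list)
  have nth: "edges X ! i = edges Y ! s i" if "i < length (edges X)" for i
    using s that len permute_list_nth[OF s(1), of i] by simp
  have lt: "s i < length (edges Y) \<longleftrightarrow> i < length (edges Y)" for i
    using permutes_in_image[OF s(1), of i] by simp
  have inj: "s i = s j \<longleftrightarrow> i = j" for i j
    using permutes_inj[OF s(1)] by (simp add: inj_eq)
  have st: "start X h = start Y ?h" "start X k = start Y ?k"
    "start X (opp h) = start Y (opp ?h)" "start X (opp k) = start Y (opp ?k)"
    using hk nth by (simp_all add: start_in_def)
  have hk': "fst ?h < length (edges Y)" "fst ?k < length (edges Y)" "fst ?h \<noteq> fst ?k"
    using hk lt inj len by auto
  have "edges (glue h k X) = permute_list s (edges (glue ?h ?k Y))"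
  proof (rule nth_equalityI)
    fix i assume "i < length (edges (glue h k X))"
    then have i: "i < length (edges X)" by simp
    have "permute_list s (edges (glue ?h ?k Y)) ! i = edges (glue ?h ?k Y) ! s i"
      using i len s(1) by (intro permute_list_nth) simp_all
    also have "\<dots> = edges (glue h k X) ! i"
      unfolding edges_simps(3)[OF hk] edges_simps(3)[OF hk'] st
      using i nth[OF i] hk hk' lt len inj by (auto simp: nth_list_update)
    finally show "edges (glue h k X) ! i = permute_list s (edges (glue ?h ?k Y)) ! i" by simp
  qed (simp add: len)
  then have "mset (edges (glue h k X)) = mset (edges (glue ?h ?k Y))"
    using s(1) by simp
  then have "collapse (fst h) (glue h k X) = (collapse (fst ?h) (glue ?h ?k Y) :: 'k graph_space)"
    if "start X h \<noteq> start X k"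
    using that hk hk' n nth_glue(1)[OF hk] nth_glue(1)[OF hk']
    by (intro collapse_mset) (simp_all add: st)
  then show ?thesis by (simp add: glue_collapse_def st glue_sign_def)
qed

lemma glue_collapse_sym:
  assumes hk: "fst h < length (edges X)" "fst k < length (edges X)" "fst h \<noteq> fst k"
  shows "glue_collapse h k X = (glue_collapse k h X :: 'k::field_char_0 graph_space)"
proof (cases "start X h = start X k")
  case True
  then show ?thesis by (simp add: glue_collapse_def)
next
  case False
  let ?G = "glue h k X" and ?i = "fst h" and ?j = "fst k"
  let ?R = "reverse_edge ?i (reverse_edge ?j ?G)"
  have R: "edges ?R = (edges X)[?i := (start X k, start X h), ?j := (start X (opp h), start X (opp k))]"
    using hk by (simp add: edges_simps list_update_swap)
  have K: "edges (glue k h X) = (edges X)[?j := (start X k, start X h), ?i := (start X (opp h), start X (opp k))]"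
    using hk by (simp add: edges_simps)
  have "mset (edges (glue k h X)) = mset (edges ?R)"
  proof -
    have "edges (glue k h X) = (edges ?R)[?i := edges ?R ! ?j, ?j := edges ?R ! ?i]"
      unfolding R K using hk by (simp add: list_update_swap)
    then show ?thesis using hk by (simp add: mset_swap)
  qed
  then have "collapse ?j (glue k h X) = (collapse ?i ?R :: 'k graph_space)"
    using hk False by (intro collapse_mset) (simp_all add: R K)
  also have "\<dots> = - collapse ?i (reverse_edge ?j ?G)"
    using hk False by (intro collapse_reverse) (simp_all add: edges_simps)
  also have "collapse ?i (reverse_edge ?j ?G) = - (collapse ?i ?G :: 'k graph_space)"
    using hk False by (intro collapse_reverse) (simp_all add: edges_simps)
  finally show ?thesis
    using False by (auto simp: glue_collapse_def glue_sign_def)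
qed

text \<open>
  Two half-edges \<open>h\<close>, \<open>k\<close> satisfy \<open>k \<noteq> h\<close> and \<open>k \<noteq> opp h\<close> iff they lie in different edges, so every
  unordered pair in the sum for \<open>\<partial>\<^sub>H\<close> is represented exactly once by an ordered pair with
  \<open>fst h < fst k\<close>.  The choice between \<open>(h, k)\<close> and \<open>(k, h)\<close> is immaterial by \<open>glue_collapse_sym\<close>.
\<close>

definition dH_gen :: "lgraph \<Rightarrow> 'k::field_char_0 graph_space" where
  "dH_gen X = (\<Sum>(h, k) | h \<in> half_edges X \<and> k \<in> half_edges X \<and> fst h < fst k. glue_collapse h k X)"

definition half_edge_pairs :: "lgraph \<Rightarrow> (half_edge \<times> half_edge) set" where
  "half_edge_pairs X = {(h, k). h \<in> half_edges X \<and> k \<in> half_edges X \<and> fst h \<noteq> fst k}"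

lemma finite_half_edge_pairs: "finite (half_edge_pairs X)"
  by (rule finite_subset[of _ "half_edges X \<times> half_edges X"])
    (auto simp: half_edge_pairs_def half_edges_def)

lemma dH_gen_double:
  "dH_gen X + dH_gen X =
    (\<Sum>(h, k)\<in>half_edge_pairs X. glue_collapse h k X :: 'k::field_char_0 graph_space)"
proof -
  let ?A = "{(h, k). h \<in> half_edges X \<and> k \<in> half_edges X \<and> fst h < fst k}"
  let ?B = "{(h, k). h \<in> half_edges X \<and> k \<in> half_edges X \<and> fst k < fst h}"
  let ?f = "\<lambda>(h, k). glue_collapse h k X :: 'k graph_space"
  have AB: "half_edge_pairs X = ?A \<union> ?B" by (auto simp: half_edge_pairs_def)
  have fin: "finite ?A" "finite ?B"
    using finite_half_edge_pairs[of X] unfolding AB by auto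
  have "sum ?f (half_edge_pairs X) = sum ?f ?A + sum ?f ?B"
    unfolding AB by (rule sum.union_disjoint[OF fin]) auto
  also have "sum ?f ?B = sum ?f ?A"
    by (rule sum.reindex_bij_witness[of _ prod.swap prod.swap])
      (auto simp: half_edges_iff intro!: glue_collapse_sym)
  finally show ?thesis by (simp add: dH_gen_def)
qed

lemma dH_gen_eqI:
  assumes "(\<Sum>(h, k)\<in>half_edge_pairs X. glue_collapse h k X) =
    c *\<^sub>G (\<Sum>(h, k)\<in>half_edge_pairs Y. glue_collapse h k Y :: 'k::field_char_0 graph_space)"
  shows "dH_gen X = c *\<^sub>G (dH_gen Y :: 'k graph_space)"
proof -
  have "dH_gen X + dH_gen X = c *\<^sub>G dH_gen Y + c *\<^sub>G (dH_gen Y :: 'k graph_space)"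
    using assms by (simp add: dH_gen_double flip: gs.scale_right_distrib)
  then have "(1 + 1) *\<^sub>G dH_gen X = (1 + 1) *\<^sub>G (c *\<^sub>G (dH_gen Y :: 'k graph_space))"
    by (simp only: gs.scale_left_distrib gs.scale_one)
  then show ?thesis by (subst (asm) gs.scale_cancel_left) simp
qed

lemma dH_gen_respects: "respects_relations (dH_gen :: lgraph \<Rightarrow> 'k::field_char_0 graph_space)"
  unfolding respects_relations_def
proof (intro conjI allI impI)
  fix X Y assume n: "nverts X = nverts Y" and m: "mset (edges X) = mset (edges Y)"
  obtain s where s: "s permutes {..<length (edges Y)}" "permute_list s (edges Y) = edges X"
    using mset_eq_permutation[OF m] by blast
  have len: "length (edges X) = length (edges Y)" using m by (rule mset_eq_length)
  have lt: "s i < length (edges Y) \<longleftrightarrow> i < length (edges Y)" for i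
    using permutes_in_image[OF s(1), of i] by simp
  have lt': "inv s i < length (edges Y) \<longleftrightarrow> i < length (edges Y)" for i
    using permutes_in_image[OF permutes_inv[OF s(1)], of i] by simp
  have inj: "s i = s j \<longleftrightarrow> i = j" "inv s i = inv s j \<longleftrightarrow> i = j" for i j
    using permutes_inj[OF s(1)] permutes_inj[OF permutes_inv[OF s(1)]] by (simp_all add: inj_eq)
  let ?S = "\<lambda>(h, k). ((s (fst h), snd h), (s (fst k), snd k :: bool))"
  let ?T = "\<lambda>(h, k). ((inv s (fst h), snd h), (inv s (fst k), snd k :: bool))"
  have "(\<Sum>(h, k)\<in>half_edge_pairs X. glue_collapse h k X) =
      (\<Sum>(h, k)\<in>half_edge_pairs Y. glue_collapse h k Y :: 'k graph_space)"
  proof (rule sum.reindex_bij_witness[of _ ?T ?S])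
    fix x assume x: "x \<in> half_edge_pairs X"
    then show "?T (?S x) = x" "?S x \<in> half_edge_pairs Y"
      by (auto simp: permutes_inverses[OF s(1)] half_edge_pairs_def half_edges_iff lt len inj)
    obtain h k where [simp]: "x = (h, k)" by (cases x)
    show "(case ?S x of (h, k) \<Rightarrow> glue_collapse h k Y) =
        (case x of (h, k) \<Rightarrow> (glue_collapse h k X :: 'k graph_space))"
      using x glue_collapse_mset[OF n s, of h k, where 'k = 'k] by (simp add: half_edge_pairs_def half_edges_iff)
  next
    fix y assume "y \<in> half_edge_pairs Y"
    then show "?S (?T y) = y" "?T y \<in> half_edge_pairs X"
      by (auto simp: permutes_inverses[OF s(1)] half_edge_pairs_def half_edges_iff lt' len inj)
  qed
  then show "dH_gen X = (dH_gen Y :: 'k graph_space)"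
    using dH_gen_eqI[of X 1 Y] by simp
next
  fix X j assume j: "j < length (edges X)"
  let ?S = "\<lambda>(h, k). (flip_at j h, flip_at j k)"
  have "(\<Sum>(h, k)\<in>half_edge_pairs (reverse_edge j X). glue_collapse h k (reverse_edge j X)) =
      (\<Sum>(h, k)\<in>half_edge_pairs X. - (glue_collapse h k X :: 'k graph_space))"
  proof (rule sum.reindex_bij_witness[of _ ?S ?S])
    fix x assume x: "x \<in> half_edge_pairs (reverse_edge j X)"
    then show "?S (?S x) = x" "?S x \<in> half_edge_pairs X"
      by (simp_all add: half_edge_pairs_def half_edges_iff split_beta)
    obtain h k where [simp]: "x = (h, k)" by (cases x)
    show "(case ?S x of (h, k) \<Rightarrow> - glue_collapse h k X) =
        (case x of (h, k) \<Rightarrow> (glue_collapse h k (reverse_edge j X) :: 'k graph_space))"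
      using x j by (simp add: half_edge_pairs_def half_edges_iff glue_collapse_reverse)
  next
    fix y assume "y \<in> half_edge_pairs X"
    then show "?S (?S y) = y" "?S y \<in> half_edge_pairs (reverse_edge j X)"
      by (simp_all add: half_edge_pairs_def half_edges_iff split_beta)
  qed
  then show "dH_gen (reverse_edge j X) = - (dH_gen X :: 'k graph_space)"
    using dH_gen_eqI[of "reverse_edge j X" "- 1" X] by (simp add: split_beta sum_negf)
next
  fix X p q assume pq: "p \<in> {1..nverts X}" "q \<in> {1..nverts X}" "p \<noteq> (q :: nat)"
  then have t: "transpose p q permutes {1..nverts X}" by (intro permutes_swap_id)
  have "half_edge_pairs (relabel (transpose p q) X) = half_edge_pairs X"
    by (simp add: half_edge_pairs_def half_edges_def)
  then have "(\<Sum>(h, k)\<in>half_edge_pairs (relabel (transpose p q) X).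
        glue_collapse h k (relabel (transpose p q) X)) =
      (\<Sum>(h, k)\<in>half_edge_pairs X. - (glue_collapse h k X :: 'k graph_space))"
    by (intro sum.cong)
      (auto simp: half_edge_pairs_def half_edges_iff glue_collapse_relabel[OF t] sign_swap_id pq)
  then show "dH_gen (relabel (transpose p q) X) = - (dH_gen X :: 'k graph_space)"
    using dH_gen_eqI[of "relabel (transpose p q) X" "- 1" X] by (simp add: split_beta sum_negf)
qed

declare One_nat_def [simp]


text \<open>
  The linear map on \<open>graph_space\<close> induced by a function on labelled graphs; it does not depend on
  the representatives when the function respects the relations, see \<open>descend_abs\<close>.
\<close>

definition descend ::
    "(lgraph \<Rightarrow> 'k::field_char_0 graph_space) \<Rightarrow> 'k graph_space \<Rightarrow> 'k graph_space" where
  "descend F x = lin_ext F (rep_graph_space x)"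

lemma descend_abs:
  assumes "respects_relations F"
  shows "descend F (abs_graph_space x) = lin_ext F x"
proof -
  have "graph_rel (rep_graph_space (abs_graph_space x)) x"
    by (metis Quotient_graph_space Quotient_rep_abs equivp_graph_rel equivp_reflp)
  then show ?thesis using assms by (simp add: descend_def lin_ext_respects)
qed

lemma descend_gr: "respects_relations F \<Longrightarrow> descend F (gr X) = F X"
  by (simp add: gr_def descend_abs)

lemma linear_descend:
  assumes "respects_relations F"
  shows "Vector_Spaces.linear scale scale (descend F)"
proof
  fix x y :: "'a graph_space" and c :: 'a
  obtain x' y' where xy: "x = abs_graph_space x'" "y = abs_graph_space y'"
    by (metis Quotient_abs_rep Quotient_graph_space)
  show "descend F (x + y) = descend F x + descend F y"
    by (simp add: xy plus_graph_space.abs_eq descend_abs[OF assms] lin_ext_add)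
  show "descend F (c *\<^sub>G x) = c *\<^sub>G descend F x"
    by (simp add: xy scale.abs_eq descend_abs[OF assms] lin_ext_scale)
qed

definition dE :: "'k::field_char_0 graph_space \<Rightarrow> 'k graph_space" ("\<partial>\<^sub>E") where
  "\<partial>\<^sub>E = descend dE_gen"

definition dH :: "'k::field_char_0 graph_space \<Rightarrow> 'k graph_space" ("\<partial>\<^sub>H") where
  "\<partial>\<^sub>H = descend dH_gen"

lemma dE_gr: "\<partial>\<^sub>E (gr X) = dE_gen X"
  and dH_gr: "\<partial>\<^sub>H (gr X) = dH_gen X"
  by (simp_all add: dE_def dH_def descend_gr dE_gen_respects dH_gen_respects)

lemma linear_dE: "Vector_Spaces.linear scale scale \<partial>\<^sub>E"
  and linear_dH: "Vector_Spaces.linear scale scale \<partial>\<^sub>H"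
  by (simp_all add: dE_def dH_def linear_descend dE_gen_respects dH_gen_respects)

end

theory Submission
  imports Defs
begin

text \<open>
  Summing $X\langle hk\rangle$ without collapsing gives an operator $\Phi$ that does not change the
  vertices.  Collapsing an edge of $X\langle hk\rangle$ that is already present in $X$ commutes with
  the gluing, and collapsing one of the two new edges yields $X_{hk}$ or $X_{\bar k\bar h}$.
  Hence $\partial_E\Phi-\Phi\partial_E$ is a multiple of $\partial_H$, namely four times it when the
  sum runs over ordered pairs, and $\Phi$ is a null-homotopy of $\partial_H$ up to this factor.
\<close>

declare One_nat_def [simp del]

section \<open>Signed gluing and the operator \<Phi> on oriented graphs\<close>

lemma glue_relabel:
  assumes t: "t permutes {1..nverts X}"
    and hk: "fst h < length (edges X)" "fst k < length (edges X)" "fst h \<noteq> fst k"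
  shows "glue h k (relabel t X) = relabel t (glue h k X)"
proof (rule lgraph_eqI)
  show "edges (glue h k (relabel t X)) = edges (relabel t (glue h k X))"
    using t hk by (simp add: edges_simps(3) start_relabel) (simp add: edges_simps map_update)
qed simp

text \<open>Passing to \<open>(opp k, opp h)\<close> exchanges the roles of the two new edges, but
  each keeps its index and its direction. Hence the second new edge can be treated as the first new
  edge of another pair.\<close>

lemma glue_opp:
  assumes "fst h < length (edges X)" "fst k < length (edges X)" "fst h \<noteq> fst k"
  shows "glue (opp k) (opp h) X = glue h k X"
  using assms by (intro lgraph_eqI) (simp_all add: edges_simps(3) list_update_swap)

text \<open>This is X<hk> as an oriented graph, for half-edges in different edges. If
  \<open>start X h = start X k\<close>, the new edge is a loop and the value is zero by
  \<open>gr_loop\<close>, in agreement with the convention in \<open>glue_collapse\<close>.\<close>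

definition glue_gr :: "half_edge \<Rightarrow> half_edge \<Rightarrow> lgraph \<Rightarrow> 'k::field_char_0 graph_space" where
  "glue_gr h k X = of_int (glue_sign h k) *\<^sub>G gr (glue h k X)"

lemma glue_gr_transpose:
  assumes pq: "p \<in> {1..nverts X}" "q \<in> {1..nverts X}" "p \<noteq> q"
    and hk: "fst h < length (edges X)" "fst k < length (edges X)" "fst h \<noteq> fst k"
  shows "glue_gr h k (relabel (transpose p q) X) = - (glue_gr h k X :: 'k::field_char_0 graph_space)"
  using pq hk by (simp add: glue_gr_def glue_relabel permutes_swap_id gr_transpose)

text \<open>If edge \<open>j\<close> is cut, its reversed entry is overwritten and both glued graphs
  coincide; exactly one factor of \<open>glue_sign\<close> changes, since \<open>h\<close> and
  \<open>k\<close> lie in different edges. If \<open>j\<close> is not cut, the reversed arrow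
  survives in the glued graph and supplies the sign.\<close>

lemma glue_gr_reverse:
  assumes j: "j < length (edges X)"
    and hk: "fst h < length (edges X)" "fst k < length (edges X)" "fst h \<noteq> fst k"
  shows "glue_gr h k (reverse_edge j X) =
    - (glue_gr (flip_at j h) (flip_at j k) X :: 'k::field_char_0 graph_space)"
proof -
  let ?h = "flip_at j h" and ?k = "flip_at j k"
  have e: "edges (glue h k (reverse_edge j X)) =
      (edges X)[j := prod.swap (edges X ! j), fst h := (start X ?h, start X ?k),
                fst k := (start X (opp ?k), start X (opp ?h))]"
    using j hk by (simp add: edges_simps(3) start_reverse) (simp add: edges_simps(2))
  show ?thesis
  proof (cases "j = fst h \<or> j = fst k")
    case True
    have "glue h k (reverse_edge j X) = glue ?h ?k X"
      using True j hk
      by (intro lgraph_eqI) (auto simp: e edges_simps(3) list_update_overwrite2)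
    moreover have "glue_sign h k = - glue_sign ?h ?k"
      using True hk(3) by (auto simp: glue_sign_def flip_at_def)
    ultimately show ?thesis by (simp add: glue_gr_def)
  next
    case False
    then have eq: "?h = h" "?k = k" by (auto simp: flip_at_def)
    have "glue h k (reverse_edge j X) = reverse_edge j (glue h k X)"
      using False j hk eq
      by (intro lgraph_eqI) (auto simp: e edges_simps flip_at_def list_update_swap)
    then show ?thesis using j eq by (simp add: glue_gr_def gr_reverse)
  qed
qed

text \<open>Position \<open>i\<close> of \<open>permute_list s\<close> holds entry
  \<open>s i\<close>, so a half-edge in edge \<open>i\<close> of \<open>X\<close> corresponds to one
  in edge \<open>s i\<close> of \<open>Y\<close>. Gluing commutes with this renaming, and
  \<open>glue_sign\<close> sees only the second components.\<close>

lemma glue_gr_permute_list: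
  assumes n: "nverts X = nverts Y" and s: "s permutes {..<length (edges Y)}"
    "permute_list s (edges Y) = edges X"
    and hk: "fst h < length (edges X)" "fst k < length (edges X)" "fst h \<noteq> fst k"
  shows "glue_gr h k X =
    (glue_gr (s (fst h), snd h) (s (fst k), snd k) Y :: 'k::field_char_0 graph_space)"
proof -
  let ?h = "(s (fst h), snd h)" and ?k = "(s (fst k), snd k)"
  have len: "length (edges X) = length (edges Y)" using s(2) by (metis length_permute_list)
  have nth: "edges X ! i = edges Y ! s i" if "i < length (edges X)" for i
    using s that len permute_list_nth[OF s(1), of i] by simp
  have lt: "s i < length (edges Y) \<longleftrightarrow> i < length (edges Y)" for i
    using permutes_in_image[OF s(1), of i] by simp
  have inj: "s i = s j \<longleftrightarrow> i = j" for i j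
    using permutes_inj[OF s(1)] by (simp add: inj_eq)
  have st: "start X h = start Y ?h" "start X k = start Y ?k"
    "start X (opp h) = start Y (opp ?h)" "start X (opp k) = start Y (opp ?k)"
    using hk nth by (simp_all add: start_in_def)
  have hk': "fst ?h < length (edges Y)" "fst ?k < length (edges Y)" "fst ?h \<noteq> fst ?k"
    using hk lt inj len by auto
  have "edges (glue h k X) = permute_list s (edges (glue ?h ?k Y))"
  proof (rule nth_equalityI)
    fix i assume "i < length (edges (glue h k X))"
    then have i: "i < length (edges X)" by simp
    have "permute_list s (edges (glue ?h ?k Y)) ! i = edges (glue ?h ?k Y) ! s i"
      using i len s(1) by (intro permute_list_nth) simp_all
    also have "\<dots> = edges (glue h k X) ! i"
      unfolding edges_simps(3)[OF hk] edges_simps(3)[OF hk'] st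
      using i nth[OF i] hk hk' lt len inj by (auto simp: nth_list_update)
    finally show "edges (glue h k X) ! i = permute_list s (edges (glue ?h ?k Y)) ! i" by simp
  qed (simp add: len)
  then have "mset (edges (glue h k X)) = mset (edges (glue ?h ?k Y))"
    using s(1) by simp
  then have "gr (glue h k X) = (gr (glue ?h ?k Y) :: 'k graph_space)"
    using n by (intro gr_mset) simp_all
  then show ?thesis by (simp add: glue_gr_def glue_sign_def)
qed

text \<open>Ordered pairs are used because a renaming of the edges need not preserve the order of
  their indices. Each unordered pair is thereby listed twice.\<close>

definition glue_sum_gen :: "lgraph \<Rightarrow> 'k::field_char_0 graph_space" where
  "glue_sum_gen X = (\<Sum>(h, k)\<in>half_edge_pairs X. glue_gr h k X)"

lemma glue_sum_gen_respects:
  "respects_relations (glue_sum_gen :: lgraph \<Rightarrow> 'k::field_char_0 graph_space)"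
  unfolding respects_relations_def
proof (intro conjI allI impI)
  fix X Y assume n: "nverts X = nverts Y" and m: "mset (edges X) = mset (edges Y)"
  obtain s where s: "s permutes {..<length (edges Y)}" "permute_list s (edges Y) = edges X"
    using mset_eq_permutation[OF m] by blast
  have len: "length (edges X) = length (edges Y)" using m by (rule mset_eq_length)
  have lt: "s i < length (edges Y) \<longleftrightarrow> i < length (edges Y)" for i
    using permutes_in_image[OF s(1), of i] by simp
  have lt': "inv s i < length (edges Y) \<longleftrightarrow> i < length (edges Y)" for i
    using permutes_in_image[OF permutes_inv[OF s(1)], of i] by simp
  have inj: "s i = s j \<longleftrightarrow> i = j" "inv s i = inv s j \<longleftrightarrow> i = j" for i j
    using permutes_inj[OF s(1)] permutes_inj[OF permutes_inv[OF s(1)]] by (simp_all add: inj_eq)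
  let ?S = "\<lambda>(h, k). ((s (fst h), snd h), (s (fst k), snd k :: bool))"
  let ?T = "\<lambda>(h, k). ((inv s (fst h), snd h), (inv s (fst k), snd k :: bool))"
  show "glue_sum_gen X = (glue_sum_gen Y :: 'k graph_space)"
    unfolding glue_sum_gen_def
  proof (rule sum.reindex_bij_witness[of _ ?T ?S])
    fix x assume x: "x \<in> half_edge_pairs X"
    then show "?T (?S x) = x" "?S x \<in> half_edge_pairs Y"
      by (auto simp: permutes_inverses[OF s(1)] half_edge_pairs_def half_edges_iff lt len inj)
    obtain h k where [simp]: "x = (h, k)" by (cases x)
    show "(case ?S x of (h, k) \<Rightarrow> glue_gr h k Y) =
        (case x of (h, k) \<Rightarrow> (glue_gr h k X :: 'k graph_space))"
      using x glue_gr_permute_list[OF n s, of h k, where 'k = 'k]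
      by (simp add: half_edge_pairs_def half_edges_iff)
  next
    fix y assume "y \<in> half_edge_pairs Y"
    then show "?S (?T y) = y" "?T y \<in> half_edge_pairs X"
      by (auto simp: permutes_inverses[OF s(1)] half_edge_pairs_def half_edges_iff lt' len inj)
  qed
next
  fix X j assume j: "j < length (edges X)"
  \<comment> \<open>Exchanging the two halves of edge \<open>j\<close> is an involution, so
    \<open>?S\<close> serves as its own inverse in the reindexing.\<close>
  let ?S = "\<lambda>(h, k). (flip_at j h, flip_at j k)"
  have "glue_sum_gen (reverse_edge j X) =
      (\<Sum>(h, k)\<in>half_edge_pairs X. - (glue_gr h k X :: 'k graph_space))"
    unfolding glue_sum_gen_def
  proof (rule sum.reindex_bij_witness[of _ ?S ?S])
    fix x assume x: "x \<in> half_edge_pairs (reverse_edge j X)"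
    then show "?S (?S x) = x" "?S x \<in> half_edge_pairs X"
      by (simp_all add: half_edge_pairs_def half_edges_iff split_beta)
    obtain h k where [simp]: "x = (h, k)" by (cases x)
    show "(case ?S x of (h, k) \<Rightarrow> - glue_gr h k X) =
        (case x of (h, k) \<Rightarrow> (glue_gr h k (reverse_edge j X) :: 'k graph_space))"
      using x j by (simp add: half_edge_pairs_def half_edges_iff glue_gr_reverse)
  next
    fix y assume "y \<in> half_edge_pairs X"
    then show "?S (?S y) = y" "?S y \<in> half_edge_pairs (reverse_edge j X)"
      by (simp_all add: half_edge_pairs_def half_edges_iff split_beta)
  qed
  then show "glue_sum_gen (reverse_edge j X) = - (glue_sum_gen X :: 'k graph_space)"
    by (simp add: glue_sum_gen_def split_beta sum_negf)
next
  fix X p q assume pq: "p \<in> {1..nverts X}" "q \<in> {1..nverts X}" "p \<noteq> (q :: nat)"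
  have "half_edge_pairs (relabel (transpose p q) X) = half_edge_pairs X"
    by (simp add: half_edge_pairs_def half_edges_def)
  then have "glue_sum_gen (relabel (transpose p q) X) =
      (\<Sum>(h, k)\<in>half_edge_pairs X. - (glue_gr h k X :: 'k graph_space))"
    unfolding glue_sum_gen_def
    by (intro sum.cong) (use glue_gr_transpose[OF pq] in \<open>auto simp: half_edge_pairs_def half_edges_iff\<close>)
  then show "glue_sum_gen (relabel (transpose p q) X) = - (glue_sum_gen X :: 'k graph_space)"
    by (simp add: glue_sum_gen_def split_beta sum_negf)
qed

definition glue_sum :: "'k::field_char_0 graph_space \<Rightarrow> 'k graph_space" where
  "glue_sum = descend glue_sum_gen"

lemma glue_sum_gr: "glue_sum (gr X) = glue_sum_gen X"
  by (simp add: glue_sum_def descend_gr glue_sum_gen_respects)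

lemma linear_glue_sum: "Vector_Spaces.linear scale scale glue_sum"
  by (simp add: glue_sum_def linear_descend glue_sum_gen_respects)

section \<open>Linear maps are determined by their values on graphs\<close>

lemma span_range_gr: "gs.span (range gr) = (UNIV :: 'k::field_char_0 graph_space set)"
proof -
  have "abs_graph_space x \<in> gs.span (range gr)" for x :: "lgraph \<Rightarrow>\<^sub>0 'k"
  proof (induction x rule: update_induct)
    case const
    then show ?case using gs.span_zero by (simp add: zero_graph_space_def)
  next
    case (update f a b)
    \<comment> \<open>As \<open>a\<close> is not a key of \<open>f\<close>, setting its coefficient
      amounts to adding a multiple of a generator.\<close>
    have "Poly_Mapping.update a b f = f + free_scale b (Poly_Mapping.single a 1)"
      using update(1) by (intro poly_mapping_eqI)
        (auto simp: lookup_update lookup_add lookup_single in_keys_iff when_def)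
    then have "abs_graph_space (Poly_Mapping.update a b f) = abs_graph_space f + b *\<^sub>G gr a"
      by (simp add: gr_def plus_graph_space.abs_eq scale.abs_eq)
    then show ?case
      using update.IH by (simp add: gs.span_add gs.span_scale gs.span_base)
  qed
  then show ?thesis
    by (metis Quotient_abs_rep Quotient_graph_space UNIV_eq_I)
qed

lemma linear_eq_on_gr:
  fixes f g :: "'k::field_char_0 graph_space \<Rightarrow> 'k graph_space"
  assumes "Vector_Spaces.linear scale scale f" "Vector_Spaces.linear scale scale g"
    and "\<And>X. f (gr X) = g (gr X)"
  shows "f = g"
proof -
  interpret vector_space_pair "scale :: 'k \<Rightarrow> _" "scale :: 'k \<Rightarrow> _" ..
  show ?thesis
    using linear_eq_on[OF assms(1,2), of _ "range gr"] assms(3) by (auto simp: span_range_gr)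
qed

section \<open>Collapsing an edge that the gluing leaves intact\<close>

definition drop_index :: "nat \<Rightarrow> nat \<Rightarrow> nat" where
  "drop_index i j = (if j < i then j else j - 1)"

text \<open>Inverse to \<open>drop_index i\<close>, which renumbers the edges that remain after
  entry \<open>i\<close> is removed and is applied only to indices other than
  \<open>i\<close>.\<close>

definition skip_index :: "nat \<Rightarrow> nat \<Rightarrow> nat" where
  "skip_index i j = (if j < i then j else Suc j)"

text \<open>Gluing rewrites only the entries \<open>fst h\<close> and \<open>fst k\<close>, while
  the contraction removes entry \<open>i\<close> and renames each endpoint separately. The two
  therefore commute up to the shift of edge indices.\<close>

lemma contract12_glue:
  assumes i: "i < length (edges X)" "edges X ! i = (1, 2)"
    and hk: "fst h < length (edges X)" "fst k < length (edges X)" "fst h \<noteq> fst k"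
    and ne: "fst h \<noteq> i" "fst k \<noteq> i"
  shows "contract12 i (glue h k X) =
    glue (drop_index i (fst h), snd h) (drop_index i (fst k), snd k) (contract12 i X)"
    (is "_ = glue ?h ?k ?Z")
proof (rule lgraph_eqI)
  have Y: "i < length (edges (glue h k X))" "edges (glue h k X) ! i = (1, 2)"
    using i hk ne by (simp_all add: edges_simps)
  show "nverts (contract12 i (glue h k X)) = nverts (glue ?h ?k ?Z)"
    using i Y by (simp add: contract12_simps)
  have lt: "drop_index i j < length (edges ?Z)"
    and nth: "edges ?Z ! drop_index i j = map_prod merge12 merge12 (edges X ! j)"
    if "j < length (edges X)" "j \<noteq> i" for j
    using that i nth_remove_nth[of i j "edges X"]
    by (simp_all add: drop_index_def contract12_simps)
  have hk': "fst ?h < length (edges ?Z)" "fst ?k < length (edges ?Z)" "fst ?h \<noteq> fst ?k"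
    using hk ne lt by (auto simp: drop_index_def)
  \<comment> \<open>The new edges are assembled from starting vertices, and the contraction applies
    \<open>merge12\<close> to each of these.\<close>
  have st: "start ?Z (drop_index i (fst h'), b) = merge12 (start X (fst h', b))"
    if "fst h' < length (edges X)" "fst h' \<noteq> i" for h' :: half_edge and b
    using nth[OF that] by (simp add: start_in_def)
  show "edges (contract12 i (glue h k X)) = edges (glue ?h ?k ?Z)"
    unfolding edges_simps(3)[OF hk'] opp_def fst_conv snd_conv st[OF hk(1) ne(1)] st[OF hk(2) ne(2)]
    using i Y hk ne
    by (simp add: contract12_simps edges_simps opp_def remove_nth_update_other map_update
        flip: drop_index_def)
qed

text \<open>The edges of X_e correspond to those of X other than e, so gluing X_e in all ways is the
  same as gluing X in all ways that do not cut e and then collapsing e.\<close>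

lemma glue_sum_collapse:
  assumes i: "i < length (edges X)" and ne: "fst (edges X ! i) \<noteq> snd (edges X ! i)"
  shows "glue_sum (collapse i X) =
    (\<Sum>(h, k)\<in>{p \<in> half_edge_pairs X. fst (fst p) \<noteq> i \<and> fst (snd p) \<noteq> i}.
       of_int (glue_sign h k) *\<^sub>G (collapse i (glue h k X) :: 'k::field_char_0 graph_space))"
proof -
  interpret L: Vector_Spaces.linear scale scale "glue_sum :: 'k graph_space \<Rightarrow> _"
    by (rule linear_glue_sum)
  obtain a b where ab: "edges X ! i = (a, b)" by force
  have "a \<in> {1..nverts X}" "b \<in> {1..nverts X}" "a \<noteq> b"
    using edges_range[OF i] ab ne by auto
  note q = bring12[OF this]
  let ?q = "bring12 a b"
  let ?Y = "relabel ?q X"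
  let ?Z = "contract12 i ?Y"
  let ?P = "{p \<in> half_edge_pairs X. fst (fst p) \<noteq> i \<and> fst (snd p) \<noteq> i}"
  have Y: "i < length (edges ?Y)" "edges ?Y ! i = (1, 2)"
    using q i ab by (simp_all add: edges_simps)
  have lenZ: "length (edges ?Z) = length (edges X) - 1"
    using Y by (simp add: contract12_simps length_remove_nth)
  have drop: "drop_index i j < length (edges ?Z)" "skip_index i (drop_index i j) = j"
    if "j < length (edges X)" "j \<noteq> i" for j
    using that i by (auto simp: lenZ drop_index_def skip_index_def)
  have drop_eq: "drop_index i j = drop_index i l \<longleftrightarrow> j = l" if "j \<noteq> i" "l \<noteq> i" for j l
    using that by (auto simp: drop_index_def)
  have skip: "skip_index i j < length (edges X)" "skip_index i j \<noteq> i"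
    "drop_index i (skip_index i j) = j" if "j < length (edges ?Z)" for j
    using that i by (auto simp: lenZ drop_index_def skip_index_def)
  have skip_eq: "skip_index i j = skip_index i l \<longleftrightarrow> j = l" for j l
    by (auto simp: skip_index_def)
  let ?S = "\<lambda>(h, k). ((drop_index i (fst h), snd h), (drop_index i (fst k), snd k :: bool))"
  let ?T = "\<lambda>(h, k). ((skip_index i (fst h), snd h), (skip_index i (fst k), snd k :: bool))"
  have "glue_sum (collapse i X) =
      (\<Sum>(h, k)\<in>half_edge_pairs ?Z. of_int (sign ?q) *\<^sub>G (glue_gr h k ?Z :: 'k graph_space))"
    by (simp add: collapse_pair[of X i a b] ab L.scale glue_sum_gr glue_sum_gen_def
        gs.scale_sum_right split_beta)
  also have "\<dots> = (\<Sum>(h, k)\<in>?P. of_int (glue_sign h k) *\<^sub>G collapse i (glue h k X))"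
  proof (rule sum.reindex_bij_witness[of _ ?S ?T])
    fix y assume "y \<in> half_edge_pairs ?Z"
    then show "?S (?T y) = y" "?T y \<in> ?P"
      by (auto simp: half_edge_pairs_def half_edges_iff skip skip_eq)
  next
    fix x assume x: "x \<in> ?P"
    then show "?T (?S x) = x" "?S x \<in> half_edge_pairs ?Z"
      by (auto simp: half_edge_pairs_def half_edges_iff drop drop_eq)
  next
    fix y assume y: "y \<in> half_edge_pairs ?Z"
    obtain h k where hk: "?T y = (h, k)" by (cases "?T y")
    have hk': "fst h < length (edges X)" "fst k < length (edges X)" "fst h \<noteq> fst k"
      "fst h \<noteq> i" "fst k \<noteq> i"
      using y hk by (auto simp: half_edge_pairs_def half_edges_iff skip skip_eq)
    have "y = ?S (h, k)" using y hk by (auto simp: half_edge_pairs_def half_edges_iff skip)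
    \<comment> \<open>Edge \<open>i\<close> still runs from \<open>a\<close> to \<open>b\<close>
      after the gluing, so the same relabelling \<open>?q\<close>, with the same sign, prepares both
      graphs for contraction.\<close>
    moreover have "collapse i (glue h k X) =
        of_int (sign ?q) *\<^sub>G (gr (contract12 i (glue h k ?Y)) :: 'k graph_space)"
      using hk' q(1) by (subst collapse_pair[of _ i a b]) (simp_all add: ab edges_simps glue_relabel)
    ultimately show "(case ?T y of (h, k) \<Rightarrow> of_int (glue_sign h k) *\<^sub>G collapse i (glue h k X)) =
        (case y of (h, k) \<Rightarrow> of_int (sign ?q) *\<^sub>G (glue_gr h k ?Z :: 'k graph_space))"
      unfolding hk using hk' contract12_glue[OF Y, of h k]
      by (simp add: glue_gr_def glue_sign_def mult.commute)
  qed
  finally show ?thesis .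
qed

section \<open>The homotopy formula\<close>

text \<open>The edges of X<hk> are the two new ones and the uncut edges of X. By
  \<open>glue_opp\<close>, the new edge with index \<open>fst k\<close> plays for
  \<open>(opp k, opp h)\<close> the part that the one with index \<open>fst h\<close> plays for
  \<open>(h, k)\<close>, and both pairs have the same \<open>glue_sign\<close>.\<close>

lemma dE_gen_glue:
  assumes hk: "fst h < length (edges X)" "fst k < length (edges X)" "fst h \<noteq> fst k"
  shows "of_int (glue_sign h k) *\<^sub>G dE_gen (glue h k X) =
    glue_collapse h k X + glue_collapse (opp k) (opp h) X +
    (\<Sum>i | i \<in> {i. i < length (edges X) \<and> fst (edges X ! i) \<noteq> snd (edges X ! i)} \<and>
         fst h \<noteq> i \<and> fst k \<noteq> i.
       of_int (glue_sign h k) *\<^sub>G (collapse i (glue h k X) :: 'k::field_char_0 graph_space))"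
    (is "_ = _ + _ + sum ?c ?B")
proof -
  let ?G = "glue h k X"
  let ?A = "{i. i < length (edges ?G) \<and> fst (edges ?G ! i) \<noteq> snd (edges ?G ! i)}"
  have fin: "finite ?A" by simp
  have nth: "edges ?G ! i = edges X ! i" if "fst h \<noteq> i" "fst k \<noteq> i" for i
    using that hk by (simp add: edges_simps)
  have B: "?A - {fst h, fst k} = ?B" using nth by auto
  \<comment> \<open>A new edge is a loop exactly when the corresponding \<open>glue_collapse\<close>
    is zero by definition, so omitting loops in \<open>dE_gen\<close> matches that
    convention.\<close>
  have h: "fst h \<in> ?A \<longleftrightarrow> start X h \<noteq> start X k"
    and k: "fst k \<in> ?A \<longleftrightarrow> start X (opp k) \<noteq> start X (opp h)"
    using hk by (simp_all add: nth_glue)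
  have "sum ?c ?A = sum ?c (?A \<inter> {fst h, fst k}) + sum ?c (?A - {fst h, fst k})"
    using fin by (subst sum.union_disjoint[symmetric]) (auto intro!: sum.cong)
  also have "sum ?c (?A \<inter> {fst h, fst k}) =
      (if fst h \<in> ?A then ?c (fst h) else 0) + (if fst k \<in> ?A then ?c (fst k) else 0)"
    using hk(3) by (auto simp: Int_insert_right simp del: mem_Collect_eq)
  also have "(if fst h \<in> ?A then ?c (fst h) else 0) = glue_collapse h k X"
    unfolding h by (simp add: glue_collapse_def)
  also have "(if fst k \<in> ?A then ?c (fst k) else 0) = glue_collapse (opp k) (opp h) X"
    unfolding k using hk by (simp add: glue_collapse_def glue_opp glue_sign_def)
  finally show ?thesis unfolding B by (simp add: dE_gen_def gs.scale_sum_right)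
qed

text \<open>The map sending \<open>(h, k)\<close> to \<open>(opp k, opp h)\<close> is an involution
  of the ordered pairs, because \<open>opp\<close> preserves the underlying edge.\<close>

lemma sum_glue_collapse_opp:
  "(\<Sum>(h, k)\<in>half_edge_pairs X. glue_collapse (opp k) (opp h) X) =
    (\<Sum>(h, k)\<in>half_edge_pairs X. glue_collapse h k X :: 'k::field_char_0 graph_space)"
  by (rule sum.reindex_bij_witness[of _ "\<lambda>(h, k). (opp k, opp h)" "\<lambda>(h, k). (opp k, opp h)"])
    (auto simp: half_edge_pairs_def half_edges_iff)

text \<open>Each of the two new edges contributes the sum of \<open>glue_collapse\<close> over
  ordered pairs, which is twice \<open>\<partial>\<^sub>H (gr X)\<close>; this gives the factor 4.
  The uncut edges account for the other term.\<close>

lemma dE_glue_sum_gr: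
  "\<partial>\<^sub>E (glue_sum (gr X)) = glue_sum (\<partial>\<^sub>E (gr X)) + 4 *\<^sub>G \<partial>\<^sub>H (gr X :: 'k::field_char_0 graph_space)"
proof -
  interpret L: Vector_Spaces.linear scale scale "glue_sum :: 'k graph_space \<Rightarrow> _"
    by (rule linear_glue_sum)
  interpret E: Vector_Spaces.linear scale scale "\<partial>\<^sub>E :: 'k graph_space \<Rightarrow> _"
    by (rule linear_dE)
  let ?N = "{i. i < length (edges X) \<and> fst (edges X ! i) \<noteq> snd (edges X ! i)}"
  let ?P = "half_edge_pairs X"
  let ?c = "\<lambda>i p. of_int (glue_sign (fst p) (snd p)) *\<^sub>G
    (collapse i (glue (fst p) (snd p) X) :: 'k graph_space)"
  let ?R = "\<lambda>i p. fst (fst p) \<noteq> i \<and> fst (snd p :: half_edge) \<noteq> i"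
  let ?D = "\<Sum>(h, k)\<in>?P. glue_collapse h k X :: 'k graph_space"
  have "\<partial>\<^sub>E (glue_sum (gr X)) =
      (\<Sum>(h, k)\<in>?P. of_int (glue_sign h k) *\<^sub>G (dE_gen (glue h k X) :: 'k graph_space))"
    by (simp add: glue_sum_gr glue_sum_gen_def glue_gr_def E.sum E.scale dE_gr split_beta)
  also have "\<dots> = (\<Sum>p\<in>?P. glue_collapse (fst p) (snd p) X +
      glue_collapse (opp (snd p)) (opp (fst p)) X + (\<Sum>i | i \<in> ?N \<and> ?R i p. ?c i p))"
    by (intro sum.cong) (auto simp: dE_gen_glue half_edge_pairs_def half_edges_iff)
  also have "\<dots> = ?D + ?D + (\<Sum>p\<in>?P. \<Sum>i | i \<in> ?N \<and> ?R i p. ?c i p)"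
    using sum_glue_collapse_opp[of X, where 'k = 'k] by (simp add: sum.distrib split_beta)
  \<comment> \<open>Choosing the collapsed edge first and then a pair that avoids it gives the sums
    of \<open>glue_sum_collapse\<close>.\<close>
  also have "(\<Sum>p\<in>?P. \<Sum>i | i \<in> ?N \<and> ?R i p. ?c i p) = (\<Sum>i\<in>?N. \<Sum>p | p \<in> ?P \<and> ?R i p. ?c i p)"
    by (rule sum.swap_restrict) (simp_all add: finite_half_edge_pairs)
  also have "\<dots> = glue_sum (\<partial>\<^sub>E (gr X))"
    by (simp add: dE_gr dE_gen_def L.sum glue_sum_collapse split_beta)
  also have "?D + ?D = 4 *\<^sub>G \<partial>\<^sub>H (gr X)"
  proof -
    \<comment> \<open>Split in this way, the scalar yields two copies of
      \<open>dH_gen X + dH_gen X\<close>, each of which \<open>dH_gen_double\<close> turns into a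
      sum over ordered pairs.\<close>
    have "4 *\<^sub>G \<partial>\<^sub>H (gr X) = (1 + 1 + (1 + 1)) *\<^sub>G (dH_gen X :: 'k graph_space)"
      by (simp add: dH_gr)
    then show ?thesis
      by (simp only: gs.scale_left_distrib gs.scale_one dH_gen_double)
  qed
  finally show ?thesis by (simp add: add.commute)
qed

lemma dE_glue_sum:
  "\<partial>\<^sub>E (glue_sum x) = glue_sum (\<partial>\<^sub>E x) + 4 *\<^sub>G \<partial>\<^sub>H (x :: 'k::field_char_0 graph_space)"
proof -
  interpret vector_space_pair "scale :: 'k \<Rightarrow> _" "scale :: 'k \<Rightarrow> _" ..
  have "\<partial>\<^sub>E \<circ> glue_sum = (\<lambda>x. (glue_sum \<circ> \<partial>\<^sub>E) x + 4 *\<^sub>G \<partial>\<^sub>H (x :: 'k graph_space))"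
    by (intro linear_eq_on_gr linear_compose_add linear_compose_scale_right linear_dH
        Vector_Spaces.linear_compose[OF linear_glue_sum linear_dE]
        Vector_Spaces.linear_compose[OF linear_dE linear_glue_sum])
      (simp add: dE_glue_sum_gr)
  then show ?thesis by (simp add: fun_eq_iff)
qed

theorem proposition7p6:
  fixes X :: "'k::field_char_0 graph_space"
  assumes "\<partial>\<^sub>E X = 0"
  shows "\<partial>\<^sub>H X \<in> range \<partial>\<^sub>E"
proof -
  interpret E: Vector_Spaces.linear scale scale "\<partial>\<^sub>E :: 'k graph_space \<Rightarrow> _"
    by (rule linear_dE)
  interpret L: Vector_Spaces.linear scale scale "glue_sum :: 'k graph_space \<Rightarrow> _"
    by (rule linear_glue_sum)
  \<comment> \<open>Since \<open>X\<close> is a cycle, the term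
    \<open>glue_sum (\<partial>\<^sub>E X)\<close> vanishes and \<open>glue_sum X\<close> has
    boundary four times \<open>\<partial>\<^sub>H X\<close>; characteristic zero allows division by
    4.\<close>
  have "\<partial>\<^sub>E ((1 / 4) *\<^sub>G glue_sum X) = \<partial>\<^sub>H X"
    by (simp add: E.scale dE_glue_sum assms L.zero)
  then show ?thesis by (metis rangeI)
qed

end
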